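(* Let $U\subset\mathbb{R}^n$ be a bounded domain with smooth boundary and let $(u_1,u_2)\in C(\overline U)^2$. Then $(u_1,u_2)$ is a viscosity subsolution of the system (S) in $U$ if and only if $(u_1,u_2)$ enjoys comparison with generalized cones from above in $U$. Likewise, $(u_1,u_2)$ is a viscosity supersolution of (S) in $U$ if and only if it enjoys comparison with generalized cones from below in $U$.
   Context: For $\varphi\in C^2$ near $x$, set $\Delta_\infty\varphi(x)=|D\varphi(x)|^{-2}\sum_{k,l=1}^n\varphi_{x_k}\varphi_{x_l}\varphi_{x_kx_l}(x)$ when $D\varphi(x)\neq0$. Define $\Delta_\infty^+\varphi(x)=\Delta_\infty\varphi(x)$ if $D\varphi(x)\ne0$ and $\Delta_\infty^+\varphi(x)=\max\{D^2\varphi(x)v\cdot v: v\in\mathbb{S}^{n-1}\}$ if $D\varphi(x)=0$; define $\Delta_\infty^-\varphi(x)$ in the same way with $\min$ in place of $\max$. The system (S) on an open set $\Omega$ is: $-\Delta_\infty u_1+u_1-u_2=0$ and $-\Delta_\infty u_2+u_2-u_1=0$ in $\Omega$. A pair $(u_1,u_2)$ of upper semicontinuous functions on $\Omega$ is a viscosity subsolution of (S) in $\Omega$ if for each $i\in\{1,2\}$, $j=3-i$, and each $\varphi\in C^2(\Omega)$ such that $u_i-\varphi$ has a local maximum at $x_0\in\Omega$, one has $-\Delta_\infty^+\varphi(x_0)+u_i(x_0)-u_j(x_0)\le0$. A pair of lower semicontinuous functions on $\Omega$ is a viscosity supersolution if for each $i$, $j=3-i$, and each $\varphi\in C^2(\Omega)$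 such that $u_i-\varphi$ has a local minimum at $x_0\in\Omega$, one has $-\Delta_\infty^-\varphi(x_0)+u_i(x_0)-u_j(x_0)\ge0$. A viscosity solution is a pair that is both a subsolution and a supersolution. Generalized cones: for $x_0\in\mathbb{R}^n$ and $C_1,C_2,a,b\in\mathbb{R}$, $\psi_1(x)=C_1e^{\sqrt2|x-x_0|}+C_2e^{-\sqrt2|x-x_0|}+a|x-x_0|+b$ and $\psi_2(x)=-C_1e^{\sqrt2|x-x_0|}-C_2e^{-\sqrt2|x-x_0|}+a|x-x_0|+b$. A pair $(u_1,u_2)\in C(\overline U)^2$ enjoys comparison with generalized cones from above in $U$ if for every $x_0\in U$, every $r>0$ with $\overline B(x_0,r)\subset U$ and every $C_1,C_2,a,b\in\mathbb{R}$, with $(\psi_1,\psi_2)$ the generalized cones centered at $x_0$ with these parameters: if $u_i\le\psi_i$ on $\partial B(x_0,r)\cup\{x_0\}$ for $i=1,2$, then $u_i\le\psi_i$ on $\overline B(x_0,r)$ for $i=1,2$. Comparison from below is defined identically with all inequalities $\le$ replaced by $\ge$. *)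

theory Defs
  imports "HOL-Analysis.Analysis"
begin

definition partial :: "'n::finite \<Rightarrow> (real^'n \<Rightarrow> real) \<Rightarrow> real^'n \<Rightarrow> real" where
  "partial k f x = frechet_derivative f (at x) (axis k 1)"

fun Ck_on :: "nat \<Rightarrow> (real^'n::finite) set \<Rightarrow> (real^'n \<Rightarrow> real) \<Rightarrow> bool" where
  "Ck_on 0 S f = continuous_on S f"
| "Ck_on (Suc k) S f =
     (continuous_on S f \<and> (\<forall>x\<in>S. f differentiable (at x)) \<and>
      (\<forall>i. Ck_on k S (partial i f)))"

definition C2_on :: "(real^'n::finite) set \<Rightarrow> (real^'n \<Rightarrow> real) \<Rightarrow> bool" where
  "C2_on S f \<longleftrightarrow> Ck_on 2 S f"

definition Cinf_on :: "(real^'n::finite) set \<Rightarrow> (real^'n \<Rightarrow> real) \<Rightarrow> bool" where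
  "Cinf_on S f \<longleftrightarrow> (\<forall>k. Ck_on k S f)"

definition grad :: "(real^'n::finite \<Rightarrow> real) \<Rightarrow> real^'n \<Rightarrow> real^'n" where
  "grad f x = (\<chi> k. partial k f x)"

definition hessq :: "(real^'n::finite \<Rightarrow> real) \<Rightarrow> real^'n \<Rightarrow> real^'n \<Rightarrow> real" where
  "hessq f x v = (\<Sum>k\<in>UNIV. \<Sum>l\<in>UNIV. partial l (partial k f) x * v$k * v$l)"

definition inf_lap :: "(real^'n::finite \<Rightarrow> real) \<Rightarrow> real^'n \<Rightarrow> real" where
  "inf_lap f x = hessq f x (grad f x) / (norm (grad f x))^2"

definition inf_lap_plus :: "(real^'n::finite \<Rightarrow> real) \<Rightarrow> real^'n \<Rightarrow> real" where
  "inf_lap_plus f x = (if grad f x \<noteq> 0 then inf_lap f x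
     else Sup ((\<lambda>v. hessq f x v) ` sphere 0 1))"

definition inf_lap_minus :: "(real^'n::finite \<Rightarrow> real) \<Rightarrow> real^'n \<Rightarrow> real" where
  "inf_lap_minus f x = (if grad f x \<noteq> 0 then inf_lap f x
     else Inf ((\<lambda>v. hessq f x v) ` sphere 0 1))"

definition usc_on :: "(real^'n::finite) set \<Rightarrow> (real^'n \<Rightarrow> real) \<Rightarrow> bool" where
  "usc_on S f \<longleftrightarrow> (\<forall>x\<in>S. \<forall>c. f x < c \<longrightarrow> (\<forall>\<^sub>F y in at x within S. f y < c))"

definition lsc_on :: "(real^'n::finite) set \<Rightarrow> (real^'n \<Rightarrow> real) \<Rightarrow> bool" where
  "lsc_on S f \<longleftrightarrow> (\<forall>x\<in>S. \<forall>c. c < f x \<longrightarrow> (\<forall>\<^sub>F y in at x within S. c < f y))"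

definition local_max_on :: "(real^'n::finite) set \<Rightarrow> (real^'n \<Rightarrow> real) \<Rightarrow> real^'n \<Rightarrow> bool" where
  "local_max_on S g x0 \<longleftrightarrow> x0 \<in> S \<and> (\<exists>e>0. \<forall>y\<in>S. dist y x0 < e \<longrightarrow> g y \<le> g x0)"

definition local_min_on :: "(real^'n::finite) set \<Rightarrow> (real^'n \<Rightarrow> real) \<Rightarrow> real^'n \<Rightarrow> bool" where
  "local_min_on S g x0 \<longleftrightarrow> x0 \<in> S \<and> (\<exists>e>0. \<forall>y\<in>S. dist y x0 < e \<longrightarrow> g x0 \<le> g y)"

definition visc_sub :: "(real^'n::finite) set \<Rightarrow> (real^'n \<Rightarrow> real) \<Rightarrow> (real^'n \<Rightarrow> real) \<Rightarrow> bool" where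
  "visc_sub \<Omega> u1 u2 \<longleftrightarrow> usc_on \<Omega> u1 \<and> usc_on \<Omega> u2 \<and>
    (\<forall>\<phi> x0. C2_on \<Omega> \<phi> \<and> local_max_on \<Omega> (\<lambda>x. u1 x - \<phi> x) x0 \<longrightarrow>
        - inf_lap_plus \<phi> x0 + u1 x0 - u2 x0 \<le> 0) \<and>
    (\<forall>\<phi> x0. C2_on \<Omega> \<phi> \<and> local_max_on \<Omega> (\<lambda>x. u2 x - \<phi> x) x0 \<longrightarrow>
        - inf_lap_plus \<phi> x0 + u2 x0 - u1 x0 \<le> 0)"

definition visc_super :: "(real^'n::finite) set \<Rightarrow> (real^'n \<Rightarrow> real) \<Rightarrow> (real^'n \<Rightarrow> real) \<Rightarrow> bool" where
  "visc_super \<Omega> u1 u2 \<longleftrightarrow> lsc_on \<Omega> u1 \<and> lsc_on \<Omega> u2 \<and>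
    (\<forall>\<phi> x0. C2_on \<Omega> \<phi> \<and> local_min_on \<Omega> (\<lambda>x. u1 x - \<phi> x) x0 \<longrightarrow>
        - inf_lap_minus \<phi> x0 + u1 x0 - u2 x0 \<ge> 0) \<and>
    (\<forall>\<phi> x0. C2_on \<Omega> \<phi> \<and> local_min_on \<Omega> (\<lambda>x. u2 x - \<phi> x) x0 \<longrightarrow>
        - inf_lap_minus \<phi> x0 + u2 x0 - u1 x0 \<ge> 0)"

definition gcone1 :: "real^'n::finite \<Rightarrow> real \<Rightarrow> real \<Rightarrow> real \<Rightarrow> real \<Rightarrow> real^'n \<Rightarrow> real" where
  "gcone1 x0 C1 C2 a b x = C1 * exp (sqrt 2 * norm (x - x0)) + C2 * exp (- sqrt 2 * norm (x - x0))
     + a * norm (x - x0) + b"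

definition gcone2 :: "real^'n::finite \<Rightarrow> real \<Rightarrow> real \<Rightarrow> real \<Rightarrow> real \<Rightarrow> real^'n \<Rightarrow> real" where
  "gcone2 x0 C1 C2 a b x = - C1 * exp (sqrt 2 * norm (x - x0)) - C2 * exp (- sqrt 2 * norm (x - x0))
     + a * norm (x - x0) + b"

definition cone_comp_above :: "(real^'n::finite) set \<Rightarrow> (real^'n \<Rightarrow> real) \<Rightarrow> (real^'n \<Rightarrow> real) \<Rightarrow> bool" where
  "cone_comp_above U u1 u2 \<longleftrightarrow>
    (\<forall>x0\<in>U. \<forall>r>0. cball x0 r \<subseteq> U \<longrightarrow> (\<forall>C1 C2 a b.
       (\<forall>x\<in>sphere x0 r \<union> {x0}. u1 x \<le> gcone1 x0 C1 C2 a b x \<and> u2 x \<le> gcone2 x0 C1 C2 a b x) \<longrightarrow>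
       (\<forall>x\<in>cball x0 r. u1 x \<le> gcone1 x0 C1 C2 a b x \<and> u2 x \<le> gcone2 x0 C1 C2 a b x)))"

definition cone_comp_below :: "(real^'n::finite) set \<Rightarrow> (real^'n \<Rightarrow> real) \<Rightarrow> (real^'n \<Rightarrow> real) \<Rightarrow> bool" where
  "cone_comp_below U u1 u2 \<longleftrightarrow>
    (\<forall>x0\<in>U. \<forall>r>0. cball x0 r \<subseteq> U \<longrightarrow> (\<forall>C1 C2 a b.
       (\<forall>x\<in>sphere x0 r \<union> {x0}. u1 x \<ge> gcone1 x0 C1 C2 a b x \<and> u2 x \<ge> gcone2 x0 C1 C2 a b x) \<longrightarrow>
       (\<forall>x\<in>cball x0 r. u1 x \<ge> gcone1 x0 C1 C2 a b x \<and> u2 x \<ge> gcone2 x0 C1 C2 a b x)))"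

definition smooth_bounded_domain :: "(real^'n::finite) set \<Rightarrow> bool" where
  "smooth_bounded_domain U \<longleftrightarrow> open U \<and> connected U \<and> U \<noteq> {} \<and> bounded U \<and>
    (\<forall>p\<in>frontier U. \<exists>r>0. \<exists>\<rho>. Cinf_on (ball p r) \<rho> \<and>
        (\<forall>x\<in>ball p r. grad \<rho> x \<noteq> 0) \<and>
        U \<inter> ball p r = {x\<in>ball p r. \<rho> x < 0} \<and>
        frontier U \<inter> ball p r = {x\<in>ball p r. \<rho> x = 0})"

end

theory Submission
  imports Defs
begin

text \<open>
  The radial profiles of the generalized cones solve the ordinary differential system
  f1'' = f1 - f2, f2'' = f2 - f1.

  Subsolutions obey comparison: bend the profiles to strict supersolutions F1, F2 by adding
  \<epsilon> (K - t^2). A test function F(|x - x0|) is useless where F' = 0 and F'' < 0, since there the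
  upper infinity Laplacian is 0 in dimension at least 2. This is avoided by a one-dimensional
  doubling of variables: maximise u_i(x) - F_i(|x - x0| + \<tau>) - L \<tau>^4 over i, x and \<tau>.
  Stationarity in \<tau> gives F_i' \<noteq> 0 if \<tau> \<noteq> 0, and F_i'' \<ge> 0 if \<tau> = 0 and F_i' = 0.

  Comparison gives subsolutions: if u1 - u2 > \<kappa> at x, a cone with vertex y close to x and
  f1'' \<ge> \<kappa> improves linear interpolation of u1 between y and the sphere of radius r about y
  by \<kappa> s (r - s) / 2 at x, where s = |x - y|. Inserting the Taylor expansion of a test function
  yields \<kappa> \<le> its upper infinity Laplacian; for nonzero gradient p one takes
  y = x - (r / 2) p / |p|, for zero gradient s = \<theta> r in any direction with \<theta> small.
\<close>

section \<open>One-variable second derivative test\<close>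

text \<open>A positive derivative of \<open>f'\<close> at its zero \<open>s\<close> makes
  \<open>f'\<close> negative just left and positive just right of \<open>s\<close>. This later makes
  a polynomial touch a radial profile from above and excludes a concave critical point in the shift
  variable.\<close>

lemma strict_local_min_second_derivative:
  fixes f f' :: "real \<Rightarrow> real"
  assumes f: "\<And>t. (f has_real_derivative f' t) (at t)"
    and f': "(f' has_real_derivative D) (at s)" and "f' s = 0" "0 < D"
  obtains e where "0 < e" "\<And>t. t \<noteq> s \<Longrightarrow> \<bar>t - s\<bar> < e \<Longrightarrow> f s < f t"
proof -
  obtain a where a: "a > 0" "\<And>h. 0 < h \<Longrightarrow> h < a \<Longrightarrow> 0 < f' (s + h)"
    using DERIV_pos_inc_right[OF f' \<open>0 < D\<close>] \<open>f' s = 0\<close> by auto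
  obtain b where b: "b > 0" "\<And>h. 0 < h \<Longrightarrow> h < b \<Longrightarrow> f' (s - h) < 0"
    using DERIV_pos_inc_left[OF f' \<open>0 < D\<close>] \<open>f' s = 0\<close> by auto
  have cont: "continuous_on S f" for S
    using f by (meson DERIV_isCont continuous_at_imp_continuous_on)
  show thesis
  proof
    show "0 < min a b" using a b by simp
    fix t assume t: "t \<noteq> s" "\<bar>t - s\<bar> < min a b"
    show "f s < f t"
    proof (cases "s < t")
      case True
      then show ?thesis
      proof (rule DERIV_pos_imp_increasing_open[OF _ _ cont])
        fix x assume "s < x" "x < t"
        then have "0 < f' (s + (x - s))" using a(2)[of "x - s"] t by simp
        then show "\<exists>y. (f has_real_derivative y) (at x) \<and> 0 < y" using f by auto
      qed
    next
      case False
      then have "t < s" using t by simp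
      then show ?thesis
      proof (rule DERIV_neg_imp_decreasing_open[OF _ _ cont])
        fix x assume "t < x" "x < s"
        then have "f' (s - (s - x)) < 0" using b(2)[of "s - x"] t by simp
        then show "\<exists>y. (f has_real_derivative y) (at x) \<and> y < 0" using f by auto
      qed
    qed
  qed
qed

section \<open>Partial derivatives and the symmetry under change of sign\<close>

lemma partial_eq:
  assumes "(f has_derivative D) (at x)"
  shows "partial k f x = D (axis k 1)"
  using frechet_derivative_at[OF assms] by (simp add: partial_def)

lemma partial_cong_open:
  assumes "open S" "x \<in> S" "\<And>y. y \<in> S \<Longrightarrow> f y = g y" "f differentiable at x"
  shows "partial k f x = partial k g x"
proof -
  obtain D where D: "(f has_derivative D) (at x)"
    using assms(4) by (auto simp: differentiable_def)
  then have "(g has_derivative D) (at x)"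
    using assms by (metis has_derivative_transform_within_open)
  with D show ?thesis by (simp add: partial_eq)
qed

lemma partial_uminus:
  assumes "f differentiable at x"
  shows "partial k (\<lambda>x. - f x) x = - partial k f x"
proof -
  obtain D where D: "(f has_derivative D) (at x)"
    using assms by (auto simp: differentiable_def)
  show ?thesis
    by (simp add: partial_eq[OF D] partial_eq[OF has_derivative_minus[OF D]])
qed

lemma C2_on_D:
  assumes "C2_on S f"
  shows "continuous_on S f" "\<And>x. x \<in> S \<Longrightarrow> f differentiable at x"
    "\<And>x k. x \<in> S \<Longrightarrow> partial k f differentiable at x"
    "\<And>k. continuous_on S (partial k f)"
    "\<And>k l. continuous_on S (partial l (partial k f))"
  using assms by (auto simp: C2_on_def numeral_2_eq_2)

text \<open>\<open>partial_uminus\<close> identifies the first partials of \<open>- f\<close> only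
  at points of \<open>S\<close>; since \<open>S\<close> is open, the identity holds near
  \<open>x\<close> and can be differentiated once more.\<close>

lemma second_partial_uminus:
  assumes "C2_on S f" "open S" "x \<in> S"
  shows "partial k (\<lambda>x. - f x) differentiable at x"
    "partial l (partial k (\<lambda>x. - f x)) x = - partial l (partial k f) x"
proof -
  note C = C2_on_D[OF assms(1)]
  have eq: "- partial k f y = partial k (\<lambda>x. - f x) y" if "y \<in> S" for y
    using partial_uminus[OF C(2)[OF that]] by simp
  have d: "(\<lambda>y. - partial k f y) differentiable at x"
    using C(3)[OF assms(3)] by simp
  then obtain D where "((\<lambda>y. - partial k f y) has_derivative D) (at x)"
    by (auto simp: differentiable_def)
  then have "(partial k (\<lambda>x. - f x) has_derivative D) (at x)"
    by (rule has_derivative_transform_within_open[OF _ assms(2,3) eq])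
  then show "partial k (\<lambda>x. - f x) differentiable at x"
    by (auto simp: differentiable_def)
  show "partial l (partial k (\<lambda>x. - f x)) x = - partial l (partial k f) x"
    using partial_cong_open[OF assms(2,3) eq d, of l] partial_uminus[OF C(3)[OF assms(3)], of l k]
    by simp
qed

lemma C2_on_uminus:
  assumes "C2_on S f" "open S"
  shows "C2_on S (\<lambda>x. - f x)"
proof -
  note C = C2_on_D[OF assms(1)]
  have "continuous_on S (partial k (\<lambda>x. - f x))" for k
    by (rule continuous_on_eq[OF continuous_on_minus[OF C(4)]]) (simp add: partial_uminus C(2))
  moreover have "continuous_on S (partial l (partial k (\<lambda>x. - f x)))" for k l
    by (rule continuous_on_eq[OF continuous_on_minus[OF C(5)]])
      (simp add: second_partial_uminus[OF assms])
  ultimately show ?thesis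
    using C(1,2) second_partial_uminus(1)[OF assms]
    by (simp add: C2_on_def numeral_2_eq_2 continuous_on_minus)
qed

lemma grad_uminus: "f differentiable at x \<Longrightarrow> grad (\<lambda>x. - f x) x = - grad f x"
  by (simp add: grad_def vec_eq_iff partial_uminus)

lemma hessq_uminus:
  assumes "C2_on S f" "open S" "x \<in> S"
  shows "hessq (\<lambda>x. - f x) x v = - hessq f x v"
  by (simp add: hessq_def second_partial_uminus[OF assms] sum_negf)

lemma hessq_minus_arg: "hessq f x (- v) = hessq f x v"
  by (simp add: hessq_def)

lemma inf_lap_minus_uminus:
  assumes "C2_on S f" "open S" "x \<in> S"
  shows "inf_lap_minus (\<lambda>x. - f x) x = - inf_lap_plus f x"
proof -
  have "Inf ((\<lambda>v. hessq (\<lambda>x. - f x) x v) ` sphere 0 1) = - Sup ((\<lambda>v. hessq f x v) ` sphere 0 1)"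
    unfolding hessq_uminus[OF assms] Inf_real_def by (simp add: image_image)
  then show ?thesis
    using C2_on_D(2)[OF assms(1,3)]
    by (simp add: inf_lap_minus_def inf_lap_plus_def inf_lap_def grad_uminus
        hessq_uminus[OF assms] hessq_minus_arg)
qed

lemma inf_lap_plus_uminus:
  assumes "C2_on S f" "open S" "x \<in> S"
  shows "inf_lap_plus (\<lambda>x. - f x) x = - inf_lap_minus f x"
  using inf_lap_minus_uminus[OF C2_on_uminus[OF assms(1,2)] assms(2,3)] by simp

lemma usc_on_uminus: "usc_on S (\<lambda>x. - f x) \<longleftrightarrow> lsc_on S f"
proof
  assume *: "usc_on S (\<lambda>x. - f x)"
  show "lsc_on S f" unfolding lsc_on_def
  proof (intro ballI allI impI)
    fix x c assume "x \<in> S" "c < f x"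
    then show "\<forall>\<^sub>F y in at x within S. c < f y"
      using *[unfolded usc_on_def, rule_format, of x "- c"] by simp
  qed
next
  assume *: "lsc_on S f"
  show "usc_on S (\<lambda>x. - f x)" unfolding usc_on_def
  proof (intro ballI allI impI)
    fix x c assume "x \<in> S" "- f x < c"
    then have "\<forall>\<^sub>F y in at x within S. - c < f y"
      using *[unfolded lsc_on_def, rule_format, of x "- c"] by simp
    then show "\<forall>\<^sub>F y in at x within S. - f y < c"
      by eventually_elim simp
  qed
qed

lemma local_max_on_uminus:
  "local_max_on S (\<lambda>x. - u x - \<phi> x) x0 \<longleftrightarrow> local_min_on S (\<lambda>x. u x - (- \<phi> x)) x0"
  unfolding local_max_on_def local_min_on_def by (simp add: algebra_simps)

text \<open>Negating the test function exchanges minima with maxima and, the infinity Laplacian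
  being odd, the lower with the upper operator; the coupling is linear. Hence only subsolutions need
  to be studied.\<close>

lemma visc_super_iff_visc_sub_uminus:
  assumes "open U"
  shows "visc_super U u1 u2 \<longleftrightarrow> visc_sub U (\<lambda>x. - u1 x) (\<lambda>x. - u2 x)"
proof -
  \<comment> \<open>One equation of the system at a time, so that the result serves for both orders
    of the pair.\<close>
  have one: "(\<forall>\<phi> x0. C2_on U \<phi> \<and> local_min_on U (\<lambda>x. u x - \<phi> x) x0 \<longrightarrow>
        - inf_lap_minus \<phi> x0 + u x0 - v x0 \<ge> 0) \<longleftrightarrow>
    (\<forall>\<phi> x0. C2_on U \<phi> \<and> local_max_on U (\<lambda>x. - u x - \<phi> x) x0 \<longrightarrow>
        - inf_lap_plus \<phi> x0 + - u x0 - - v x0 \<le> 0)" (is "?L \<longleftrightarrow> ?R") for u v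
  proof
    assume L: ?L
    show ?R
    proof (intro allI impI, elim conjE)
      fix \<phi> x0 assume C: "C2_on U \<phi>" and m: "local_max_on U (\<lambda>x. - u x - \<phi> x) x0"
      then have "x0 \<in> U" by (simp add: local_max_on_def)
      have "- inf_lap_minus (\<lambda>x. - \<phi> x) x0 + u x0 - v x0 \<ge> 0"
        using L C2_on_uminus[OF C assms] m unfolding local_max_on_uminus by blast
      then show "- inf_lap_plus \<phi> x0 + - u x0 - - v x0 \<le> 0"
        unfolding inf_lap_minus_uminus[OF C assms \<open>x0 \<in> U\<close>] by simp
    qed
  next
    assume R: ?R
    show ?L
    proof (intro allI impI, elim conjE)
      fix \<phi> x0 assume C: "C2_on U \<phi>" and m: "local_min_on U (\<lambda>x. u x - \<phi> x) x0"
      then have "x0 \<in> U" by (simp add: local_min_on_def)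
      have "local_max_on U (\<lambda>x. - u x - (- \<phi> x)) x0"
        using m unfolding local_max_on_uminus[of _ _ "\<lambda>x. - \<phi> x"] by simp
      then have "- inf_lap_plus (\<lambda>x. - \<phi> x) x0 + - u x0 - - v x0 \<le> 0"
        using R C2_on_uminus[OF C assms] by blast
      then show "- inf_lap_minus \<phi> x0 + u x0 - v x0 \<ge> 0"
        unfolding inf_lap_plus_uminus[OF C assms \<open>x0 \<in> U\<close>] by simp
    qed
  qed
  show ?thesis
    unfolding visc_super_def visc_sub_def usc_on_uminus one[of u1 u2] one[of u2 u1] ..
qed

lemma gcone2_eq_gcone1: "gcone2 x0 C1 C2 a b x = gcone1 x0 (- C1) (- C2) a b x"
  by (simp add: gcone1_def gcone2_def)

lemma gcone1_uminus: "gcone1 x0 (- C1) (- C2) (- a) (- b) x = - gcone1 x0 C1 C2 a b x"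
  by (simp add: gcone1_def)

text \<open>The parameters range over all reals, and negating \<open>C1\<close> and
  \<open>C2\<close> exchanges the two cones. The viscosity inequality therefore has to be derived
  from comparison for the first component only.\<close>

lemma cone_comp_above_swap:
  "cone_comp_above U u1 u2 \<Longrightarrow> cone_comp_above U u2 u1"
  unfolding cone_comp_above_def
proof (intro ballI allI impI)
  fix x0 r C1 C2 a b x
  assume *: "\<forall>x0\<in>U. \<forall>r>0. cball x0 r \<subseteq> U \<longrightarrow> (\<forall>C1 C2 a b.
       (\<forall>x\<in>sphere x0 r \<union> {x0}. u1 x \<le> gcone1 x0 C1 C2 a b x \<and> u2 x \<le> gcone2 x0 C1 C2 a b x) \<longrightarrow>
       (\<forall>x\<in>cball x0 r. u1 x \<le> gcone1 x0 C1 C2 a b x \<and> u2 x \<le> gcone2 x0 C1 C2 a b x))"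
    and h: "x0 \<in> U" "0 < r" "cball x0 r \<subseteq> U"
      "\<forall>x\<in>sphere x0 r \<union> {x0}. u2 x \<le> gcone1 x0 C1 C2 a b x \<and> u1 x \<le> gcone2 x0 C1 C2 a b x"
      "x \<in> cball x0 r"
  show "u2 x \<le> gcone1 x0 C1 C2 a b x \<and> u1 x \<le> gcone2 x0 C1 C2 a b x"
  proof -
    have "\<forall>x\<in>sphere x0 r \<union> {x0}. u1 x \<le> gcone1 x0 (- C1) (- C2) a b x \<and>
        u2 x \<le> gcone2 x0 (- C1) (- C2) a b x"
      using h(4) by (simp add: gcone2_eq_gcone1)
    then have "u1 x \<le> gcone1 x0 (- C1) (- C2) a b x \<and> u2 x \<le> gcone2 x0 (- C1) (- C2) a b x"
      using * h(1,2,3,5) by blast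
    then show ?thesis by (simp add: gcone2_eq_gcone1)
  qed
qed

lemma cone_comp_below_iff_above_uminus:
  "cone_comp_below U u1 u2 \<longleftrightarrow> cone_comp_above U (\<lambda>x. - u1 x) (\<lambda>x. - u2 x)"
proof -
  have eq: "- u \<le> gcone1 x0 C1 C2 a b x \<longleftrightarrow> gcone1 x0 (- C1) (- C2) (- a) (- b) x \<le> u"
    for u x0 C1 C2 a b and x :: "real^'n"
    by (auto simp: gcone1_uminus)
  \<comment> \<open>Negation permutes the reals, so all four parameters may be negated under their
    quantifiers; by \<open>eq\<close> this turns cones above \<open>- u\<close> into cones below
    \<open>u\<close>.\<close>
  have "P \<longleftrightarrow> (\<forall>C1 C2 a b. Q (- C1) (- C2) (- a) (- b))"
    if "P \<longleftrightarrow> (\<forall>C1 C2 a b. Q C1 C2 a b)" for P and Q :: "real \<Rightarrow> real \<Rightarrow> real \<Rightarrow> real \<Rightarrow> bool"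
    unfolding that by (metis minus_minus)
  note flip = this[OF refl]
  show ?thesis
    unfolding cone_comp_above_def cone_comp_below_def gcone2_eq_gcone1 eq
    by (subst flip) (rule refl)
qed

section \<open>Radial test functions\<close>

text \<open>With z = x - x0 and |z| = s, the gradient is 2 \<beta> z and the Hessian is 2 \<beta> I
  + 8 \<gamma> z z^T. For \<beta> nonzero the quotient is the radial second derivative. For \<beta>
  = 0 the maximum over unit vectors counts, and Cauchy-Schwarz bounds it by the same value provided
  \<gamma> is nonnegative.\<close>

lemma radial_quadratic_test_function:
  fixes x0 :: "real^'n::finite" and \<alpha> \<beta> \<gamma> s :: real
  defines "\<phi> \<equiv> \<lambda>x. \<alpha> + \<beta> * ((norm (x - x0))\<^sup>2 - s\<^sup>2) + \<gamma> * ((norm (x - x0))\<^sup>2 - s\<^sup>2)\<^sup>2"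
  shows "C2_on S \<phi>"
    and "norm (x - x0) = s \<Longrightarrow> 0 < s \<Longrightarrow> \<beta> \<noteq> 0 \<or> 0 \<le> \<gamma> \<Longrightarrow>
      inf_lap_plus \<phi> x \<le> 2 * \<beta> + 8 * \<gamma> * s\<^sup>2"
proof -
  \<comment> \<open>Written with the inner product instead of the norm, the function is a
    polynomial, hence smooth at the vertex too.\<close>
  define W where "W = (\<lambda>x. (x - x0) \<bullet> (x - x0) - s\<^sup>2)"
  define P where "P = (\<lambda>k x. 2 * (\<beta> + 2 * \<gamma> * W x) * (x - x0)$k)"
  define Q where "Q = (\<lambda>k l x. 8 * \<gamma> * (x - x0)$l * (x - x0)$k
      + 2 * (\<beta> + 2 * \<gamma> * W x) * (if k = l then 1 else 0))"
  have phi: "\<phi> = (\<lambda>x. \<alpha> + \<beta> * W x + \<gamma> * (W x)\<^sup>2)"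
    by (simp add: \<phi>_def W_def power2_norm_eq_inner)
  have dW: "(W has_derivative (\<lambda>h. 2 * ((x - x0) \<bullet> h))) (at x)" for x
    unfolding W_def by (auto intro!: derivative_eq_intros simp: inner_commute)
  have d\<phi>: "(\<phi> has_derivative (\<lambda>h. (\<beta> + 2 * \<gamma> * W x) * (2 * ((x - x0) \<bullet> h)))) (at x)" for x
    unfolding phi by (auto intro!: derivative_eq_intros dW simp: algebra_simps)
  have dc: "((\<lambda>x. x$k) has_derivative (\<lambda>h. h$k)) (at x)" for k and x :: "real^'n"
    by (rule bounded_linear_imp_has_derivative[OF bounded_linear_vec_nth])
  have dP: "(P k has_derivative (\<lambda>h. 8 * \<gamma> * ((x - x0) \<bullet> h) * (x - x0)$k
      + 2 * (\<beta> + 2 * \<gamma> * W x) * h$k)) (at x)" for x k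
    unfolding P_def by (auto intro!: derivative_eq_intros dW dc simp: algebra_simps)
  have p1: "partial k \<phi> = P k" for k
    by (rule ext) (simp add: partial_eq[OF d\<phi>] P_def inner_axis algebra_simps)
  have ax: "axis l (1::real) $ k = (if k = l then 1 else 0)" for k l :: 'n
    by (simp add: axis_def)
  have p2: "partial l (P k) = Q k l" for k l
    by (rule ext) (auto simp: partial_eq[OF dP] Q_def inner_axis ax)
  have cQ: "continuous_on S (Q k l)" for k l
    unfolding Q_def W_def by (intro continuous_intros)
  have c: "continuous_on S \<phi>" "continuous_on S (P k)" for k
    by (rule has_derivative_continuous_on[OF has_derivative_at_withinI], rule d\<phi> dP)+
  show "C2_on S \<phi>"
    unfolding C2_on_def numeral_2_eq_2
    using c cQ differentiableI[OF d\<phi>] differentiableI[OF dP] by (simp add: p1 p2)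
  assume s: "norm (x - x0) = s" "0 < s" and or: "\<beta> \<noteq> 0 \<or> 0 \<le> \<gamma>"
  define z where "z = x - x0"
  have zz: "z \<bullet> z = s\<^sup>2" using s by (simp add: z_def power2_norm_eq_inner[symmetric])
  then have W0: "W x = 0" by (simp add: W_def z_def)
  have gr: "grad \<phi> x = (2 * \<beta>) *\<^sub>R z"
    by (simp add: vec_eq_iff grad_def p1 P_def W0 z_def)
  have hess: "hessq \<phi> x v = 2 * \<beta> * (v \<bullet> v) + 8 * \<gamma> * (z \<bullet> v)\<^sup>2" for v
  proof -
    have "hessq \<phi> x v = (\<Sum>k\<in>UNIV. \<Sum>l\<in>UNIV. 8 * \<gamma> * ((z$k * v$k) * (z$l * v$l))
        + (if k = l then 2 * \<beta> * (v$k * v$l) else 0))"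
      unfolding hessq_def p1 p2 by (intro sum.cong refl) (auto simp: Q_def W0 z_def algebra_simps)
    also have "\<dots> = 8 * \<gamma> * ((\<Sum>k\<in>UNIV. z$k * v$k) * (\<Sum>l\<in>UNIV. z$l * v$l))
        + 2 * \<beta> * (\<Sum>k\<in>UNIV. v$k * v$k)"
      by (simp add: sum.distrib flip: sum_distrib_left sum_distrib_right)
    finally show ?thesis by (simp add: inner_vec_def power2_eq_square)
  qed
  show "inf_lap_plus \<phi> x \<le> 2 * \<beta> + 8 * \<gamma> * s\<^sup>2"
  proof (cases "\<beta> = 0")
    case False
    then have "grad \<phi> x \<noteq> 0" using zz s by (auto simp: gr)
    moreover have "norm z = s" using s by (simp add: z_def)
    then have "hessq \<phi> x (grad \<phi> x) = (2 * \<beta> + 8 * \<gamma> * s\<^sup>2) * (norm (grad \<phi> x))\<^sup>2"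
      by (simp add: gr hess zz power2_eq_square algebra_simps)
    ultimately show ?thesis by (simp add: inf_lap_plus_def inf_lap_def)
  next
    case True
    then have "0 \<le> \<gamma>" using or by simp
    have "hessq \<phi> x v \<le> 8 * \<gamma> * s\<^sup>2" if "v \<in> sphere 0 1" for v
    proof -
      have "(z \<bullet> v)\<^sup>2 \<le> (z \<bullet> z) * (v \<bullet> v)" by (rule Cauchy_Schwarz_ineq)
      also have "\<dots> = s\<^sup>2" using that zz by (simp add: power2_norm_eq_inner[symmetric])
      finally show ?thesis using True \<open>0 \<le> \<gamma>\<close> by (simp add: hess mult_left_mono)
    qed
    moreover have "sphere (0::real^'n) 1 \<noteq> {}" by simp
    ultimately show ?thesis
      using True unfolding inf_lap_plus_def gr by (auto intro!: cSUP_least)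
  qed
qed

text \<open>The function \<open>g (norm (x - x0))\<close> may fail to be C^2 at the vertex, whereas
  test functions must be C^2 on all of \<open>U\<close>. It is replaced by a polynomial in the
  squared distance that touches it from above at radius \<open>s\<close>, at the cost of an
  arbitrarily small \<delta> in the second derivative.\<close>

lemma visc_sub_radial_test:
  fixes g g' :: "real \<Rightarrow> real"
  assumes sub: "visc_sub U u1 u2"
    and g: "\<And>t. (g has_real_derivative g' t) (at t)"
    and g': "(g' has_real_derivative g'') (at s)"
    and s: "norm (x - x0) = s" "0 < s"
    and mx: "local_max_on U (\<lambda>x. u1 x - g (norm (x - x0))) x"
    and nondeg: "g' s \<noteq> 0 \<or> 0 \<le> g''"
  shows "u1 x - u2 x \<le> g''"
proof (rule field_le_epsilon)
  fix \<delta> :: real assume "0 < \<delta>"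
  \<comment> \<open>The coefficients give \<open>q\<close> the slope \<open>g' s\<close> and the
    second derivative \<open>g'' + \<delta>\<close> at \<open>s\<close>, so \<open>q - g\<close> has
    a strict local minimum there. If \<open>g' s = 0\<close>, then \<beta> = 0 and
    \<open>nondeg\<close> makes \<gamma> nonnegative.\<close>
  define \<beta> where "\<beta> = g' s / (2 * s)"
  define \<gamma> where "\<gamma> = (g'' + \<delta> - 2 * \<beta>) / (8 * s\<^sup>2)"
  define q where "q = (\<lambda>t. g s + \<beta> * (t\<^sup>2 - s\<^sup>2) + \<gamma> * (t\<^sup>2 - s\<^sup>2)\<^sup>2)"
  define \<phi> where "\<phi> = (\<lambda>x. q (norm (x - x0)))"
  have C: "C2_on U \<phi>" unfolding \<phi>_def q_def by (rule radial_quadratic_test_function)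
  have val: "2 * \<beta> + 8 * \<gamma> * s\<^sup>2 = g'' + \<delta>" using s by (simp add: \<gamma>_def field_simps)
  have "\<beta> \<noteq> 0 \<or> 0 \<le> \<gamma>" using nondeg s \<open>0 < \<delta>\<close> by (auto simp: \<beta>_def \<gamma>_def)
  then have le: "inf_lap_plus \<phi> x \<le> g'' + \<delta>"
    unfolding \<phi>_def q_def val[symmetric] using radial_quadratic_test_function(2)[OF s] by simp
  have d1: "((\<lambda>t. q t - g t) has_real_derivative
      (2 * \<beta> * t + 4 * \<gamma> * (t^3 - s\<^sup>2 * t) - g' t)) (at t)" for t
    unfolding q_def
    by (auto intro!: derivative_eq_intros g simp: algebra_simps power2_eq_square power3_eq_cube)
  have d2: "((\<lambda>t. 2 * \<beta> * t + 4 * \<gamma> * (t^3 - s\<^sup>2 * t) - g' t) has_real_derivative \<delta>) (at s)"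
    using val
    by (auto intro!: derivative_eq_intros g' simp: algebra_simps power2_eq_square power3_eq_cube)
  have "2 * \<beta> * s + 4 * \<gamma> * (s^3 - s\<^sup>2 * s) - g' s = 0"
    using s by (simp add: \<beta>_def power2_eq_square power3_eq_cube)
  then obtain e where e: "0 < e" "\<And>t. t \<noteq> s \<Longrightarrow> \<bar>t - s\<bar> < e \<Longrightarrow> q s - g s < q t - g t"
    using strict_local_min_second_derivative[OF d1 d2 _ \<open>0 < \<delta>\<close>] by blast
  have qs: "q s = g s" by (simp add: q_def)
  obtain e' where e': "0 < e'" "x \<in> U"
    "\<And>y. y \<in> U \<Longrightarrow> dist y x < e' \<Longrightarrow> u1 y - g (norm (y - x0)) \<le> u1 x - g s"
    using mx s unfolding local_max_on_def by auto
  have "local_max_on U (\<lambda>x. u1 x - \<phi> x) x"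
    unfolding local_max_on_def
  proof (intro conjI exI[of _ "min e e'"] ballI impI)
    fix y assume y: "y \<in> U" "dist y x < min e e'"
    have "\<bar>norm (y - x0) - s\<bar> \<le> dist y x"
      using norm_triangle_ineq3[of "y - x0" "x - x0"] s by (simp add: dist_norm)
    then have "g (norm (y - x0)) \<le> q (norm (y - x0))"
      using e(2)[of "norm (y - x0)"] y qs by (cases "norm (y - x0) = s") auto
    then show "u1 y - \<phi> y \<le> u1 x - \<phi> x"
      using e'(3)[of y] y s qs by (simp add: \<phi>_def)
  qed (use e e' in auto)
  then have "- inf_lap_plus \<phi> x + u1 x - u2 x \<le> 0"
    using sub C unfolding visc_sub_def by blast
  then show "u1 x - u2 x \<le> g'' + \<delta>" using le by simp
qed

section \<open>Second-order Taylor bound\<close>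

text \<open>The partial derivatives are differentiable at \<open>x\<close>, so the gradient has a
  first-order expansion with error o(|h|); the mean value theorem along the segment from
  \<open>x\<close> to \<open>x + h\<close> turns it into a second-order expansion of
  \<open>f\<close>.\<close>

lemma C2_on_Taylor:
  assumes C: "C2_on S f" and "open S" "x \<in> S" and "0 < \<delta>"
  obtains \<eta> where "0 < \<eta>"
    "\<And>h. norm h < \<eta> \<Longrightarrow> f (x + h) \<le> f x + grad f x \<bullet> h + hessq f x h / 2 + \<delta> * (norm h)\<^sup>2"
proof -
  note C = C2_on_D[OF C]
  define D where "D = (\<lambda>k. frechet_derivative (partial k f) (at x))"
  have D: "(partial k f has_derivative D k) (at x)" for k
    using C(3)[OF \<open>x \<in> S\<close>] by (simp add: D_def frechet_derivative_works)
  have lin: "linear (D k)" for k using D has_derivative_linear by blast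
  have axes: "F h = (\<Sum>k\<in>UNIV. h$k * F (axis k 1))" if "linear F" for F :: "real^'a \<Rightarrow> real" and h
  proof -
    have "F h = F (\<Sum>k\<in>UNIV. h$k *\<^sub>R axis k 1)"
      using basis_expansion[of h] by (simp add: scalar_mult_eq_scaleR)
    then show ?thesis using that by (simp add: linear_sum linear_scale)
  qed
  have hq: "hessq f x h = (\<Sum>k\<in>UNIV. h$k * D k h)" for h
    unfolding hessq_def
    by (intro sum.cong refl)
      (simp add: axes[OF lin, of _ h] partial_eq[OF D] sum_distrib_left mult_ac)
  \<comment> \<open>Each of the \<open>N\<close> coordinates of the gradient is allowed the share
    \<open>\<delta> / N\<close> of the error.\<close>
  define N where "N = real CARD('a)"
  have "0 < N" by (simp add: N_def)
  have "\<exists>e>0. \<forall>h. norm h < e \<longrightarrow> \<bar>partial k f (x + h) - partial k f x - D k h\<bar> \<le> \<delta> / N * norm h" for k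
    using D[of k, unfolded has_derivative_at_alt] \<open>0 < \<delta>\<close> \<open>0 < N\<close>
    by (metis add_diff_cancel_left' divide_pos_pos real_norm_def)
  then obtain e where e: "\<And>k. 0 < e k" "\<And>k h. norm h < e k \<Longrightarrow>
      \<bar>partial k f (x + h) - partial k f x - D k h\<bar> \<le> \<delta> / N * norm h"
    by metis
  obtain e0 where e0: "0 < e0" "ball x e0 \<subseteq> S" using \<open>open S\<close> \<open>x \<in> S\<close> openE by blast
  define \<eta> where "\<eta> = Min (insert e0 (range e))"
  have \<eta>: "0 < \<eta>" "\<eta> \<le> e0" "\<And>k. \<eta> \<le> e k"
    using e0(1) e(1) unfolding \<eta>_def by (auto simp del: Min_insert intro: Min_le)
  show thesis
  proof
    show "0 < \<eta>" by fact
    fix h :: "real^'a" assume h: "norm h < \<eta>"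
    \<comment> \<open>The expansion is subtracted beforehand, so \<open>g 1 - g 0\<close> is exactly
      the Taylor remainder.\<close>
    define g where "g = (\<lambda>t. f (x + t *\<^sub>R h) - t * (grad f x \<bullet> h) - t\<^sup>2 * (hessq f x h / 2))"
    define g' where "g' = (\<lambda>t. grad f (x + t *\<^sub>R h) \<bullet> h - grad f x \<bullet> h - t * hessq f x h)"
    have th: "norm (t *\<^sub>R h) < \<eta>" if "0 \<le> t" "t \<le> 1" for t
      using that h mult_left_le_one_le[of "norm h" t] by simp
    have dg: "(g has_real_derivative g' t) (at t)" if t: "0 \<le> t" "t \<le> 1" for t
    proof -
      have "x + t *\<^sub>R h \<in> S" using th[OF t] e0 \<eta> by (auto simp: dist_norm subset_iff)
      then obtain F where F: "(f has_derivative F) (at (x + t *\<^sub>R h))"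
        using C(2) by (auto simp: differentiable_def)
      have Fh: "F h = grad f (x + t *\<^sub>R h) \<bullet> h"
        using axes[OF has_derivative_linear[OF F], of h]
        by (simp add: grad_def inner_vec_def partial_eq[OF F] mult.commute)
      have "((\<lambda>t. x + t *\<^sub>R h) has_derivative (\<lambda>a. a *\<^sub>R h)) (at t)"
        by (auto intro!: derivative_eq_intros)
      from diff_chain_at[OF this F]
      have "((\<lambda>t. f (x + t *\<^sub>R h)) has_derivative (\<lambda>a. F (a *\<^sub>R h))) (at t)"
        by (simp add: o_def)
      moreover have "(\<lambda>a. F (a *\<^sub>R h)) = (*) (F h)"
        using has_derivative_linear[OF F] by (auto simp: linear_scale mult.commute)
      ultimately have "((\<lambda>t. f (x + t *\<^sub>R h)) has_real_derivative F h) (at t)"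
        by (simp add: has_field_derivative_def)
      then show ?thesis
        unfolding g_def g'_def Fh by (auto intro!: derivative_eq_intros)
    qed
    obtain t where t: "0 < t" "t < 1" "g 1 - g 0 = (1 - 0) * g' t"
      using MVT2[of 0 1 g g'] dg by auto
    have "g' t = (\<Sum>k\<in>UNIV. (partial k f (x + t *\<^sub>R h) - partial k f x - D k (t *\<^sub>R h)) * h$k)"
      unfolding g'_def hq grad_def inner_vec_def
      by (simp add: linear_scale[OF lin] algebra_simps sum.distrib sum_subtractf sum_distrib_left)
    also have "\<dots> \<le> (\<Sum>k::'a\<in>UNIV. \<delta> / N * (norm h)\<^sup>2)"
    proof (rule sum_mono)
      fix k
      have n: "norm (t *\<^sub>R h) < \<eta>" using th t by simp
      have "\<bar>partial k f (x + t *\<^sub>R h) - partial k f x - D k (t *\<^sub>R h)\<bar> \<le> \<delta> / N * norm (t *\<^sub>R h)"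
        using e(2)[of "t *\<^sub>R h" k] n \<eta>(3)[of k] by linarith
      also have "\<dots> \<le> \<delta> / N * norm h"
        using t \<open>0 < \<delta>\<close> \<open>0 < N\<close> by (intro mult_left_mono) (auto simp: mult_left_le_one_le)
      finally have "\<bar>(partial k f (x + t *\<^sub>R h) - partial k f x - D k (t *\<^sub>R h)) * h$k\<bar>
          \<le> (\<delta> / N * norm h) * norm h"
        unfolding abs_mult using component_le_norm_cart[of h k] \<open>0 < \<delta>\<close> \<open>0 < N\<close>
        by (intro mult_mono) auto
      then show "(partial k f (x + t *\<^sub>R h) - partial k f x - D k (t *\<^sub>R h)) * h$k
          \<le> \<delta> / N * (norm h)\<^sup>2"
        by (simp add: power2_eq_square mult_ac)
    qed
    also have "\<dots> = \<delta> * (norm h)\<^sup>2" using \<open>0 < N\<close> by (simp add: N_def)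
    finally show "f (x + h) \<le> f x + grad f x \<bullet> h + hessq f x h / 2 + \<delta> * (norm h)\<^sup>2"
      using t by (simp add: g_def)
  qed
qed

section \<open>From viscosity subsolutions to comparison with cones\<close>

text \<open>Negating \<open>C1\<close> and \<open>C2\<close> yields the profile of the second
  component. Both components receive the same concave bump, which cancels in their difference but
  lowers each second derivative by 2 \<epsilon>: this is the strictness of the
  supersolution.\<close>

definition bent_profile :: "real \<Rightarrow> real \<Rightarrow> real \<Rightarrow> real \<Rightarrow> real \<Rightarrow> real \<Rightarrow> real \<Rightarrow> real" where
  "bent_profile \<epsilon> K C1 C2 a b t =
    C1 * exp (sqrt 2 * t) + C2 * exp (- sqrt 2 * t) + a * t + b + \<epsilon> * (K - t\<^sup>2)"

lemma bent_profile_derivatives: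
  obtains F' where "\<And>t. (bent_profile \<epsilon> K C1 C2 a b has_real_derivative F' t) (at t)"
    "\<And>t. (F' has_real_derivative
      bent_profile \<epsilon> K C1 C2 a b t - bent_profile \<epsilon> K (- C1) (- C2) a b t - 2 * \<epsilon>) (at t)"
proof
  let ?F' = "\<lambda>t. sqrt 2 * C1 * exp (sqrt 2 * t) - sqrt 2 * C2 * exp (- sqrt 2 * t) + a - 2 * \<epsilon> * t"
  have s: "sqrt 2 * (sqrt 2 * x) = 2 * x" for x :: real
    by (simp flip: mult.assoc)
  show "(bent_profile \<epsilon> K C1 C2 a b has_real_derivative ?F' t) (at t)" for t
    unfolding bent_profile_def[abs_def] by (auto intro!: derivative_eq_intros)
  show "(?F' has_real_derivative
      bent_profile \<epsilon> K C1 C2 a b t - bent_profile \<epsilon> K (- C1) (- C2) a b t - 2 * \<epsilon>) (at t)" for t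
    unfolding bent_profile_def by (auto intro!: derivative_eq_intros simp: s algebra_simps)
qed

lemma continuous_on_bent_profile [continuous_intros]:
  assumes "continuous_on S g"
  shows "continuous_on S (\<lambda>x. bent_profile \<epsilon> K C1 C2 a b (g x))"
  unfolding bent_profile_def by (intro continuous_intros assms)

text \<open>At fixed shift \<tau> the maximum in \<open>x\<close> allows a radial test, giving u1 -
  u2 \<le> F - G - 2 \<epsilon>, while \<open>ge\<close> (the first component has the larger excess)
  says F - G \<le> u1 - u2. The assumptions \<open>bdry\<close> and \<open>ends\<close> keep the
  maximum away from the centre, the sphere and the extreme shifts.\<close>

lemma no_interior_maximum:
  fixes x x0 :: "real^'n::finite" and \<epsilon> K C1 C2 a b :: real
  defines "F \<equiv> bent_profile \<epsilon> K C1 C2 a b"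
    and "G \<equiv> bent_profile \<epsilon> K (- C1) (- C2) a b"
  assumes sub: "visc_sub U u1 u2" and U: "cball x0 r \<subseteq> U" and "0 < \<epsilon>" "0 < L"
    and bdry: "\<And>y \<tau>. y \<in> sphere x0 r \<union> {x0} \<Longrightarrow> \<bar>\<tau>\<bar> \<le> \<eta> \<Longrightarrow> u1 y < F (norm (y - x0) + \<tau>)"
    and ends: "\<And>y \<tau>. y \<in> cball x0 r \<Longrightarrow> \<bar>\<tau>\<bar> = \<eta> \<Longrightarrow> u1 y - F (norm (y - x0) + \<tau>) \<le> L * \<eta>^4"
    and x: "x \<in> cball x0 r" and \<tau>: "\<bar>\<tau>\<bar> \<le> \<eta>"
    and mx: "\<And>y \<sigma>. y \<in> cball x0 r \<Longrightarrow> \<bar>\<sigma>\<bar> \<le> \<eta> \<Longrightarrow>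
      u1 y - F (norm (y - x0) + \<sigma>) - L * \<sigma>^4 \<le> u1 x - F (norm (x - x0) + \<tau>) - L * \<tau>^4"
    and pos: "0 < u1 x - F (norm (x - x0) + \<tau>) - L * \<tau>^4"
    and ge: "u2 x - G (norm (x - x0) + \<tau>) \<le> u1 x - F (norm (x - x0) + \<tau>)"
  shows False
proof -
  define t where "t = norm (x - x0)"
  have "0 \<le> L * \<tau>^4" using \<open>0 < L\<close> by simp
  then have "x \<notin> sphere x0 r \<union> {x0}" using bdry[of x \<tau>] pos \<tau> by fastforce
  then have "x \<noteq> x0" and xr: "dist x x0 < r" using x by (auto simp: dist_commute)
  then have "0 < t" by (simp add: t_def)
  \<comment> \<open>At an extreme shift the penalty would consume the whole positive excess.\<close>
  have \<tau>\<eta>: "\<bar>\<tau>\<bar> < \<eta>"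
  proof (rule ccontr)
    assume "\<not> \<bar>\<tau>\<bar> < \<eta>"
    then have "\<bar>\<tau>\<bar> = \<eta>" using \<tau> by simp
    moreover from this have "\<tau>^4 = \<eta>^4" by (metis even_numeral power_even_abs)
    ultimately show False using ends[OF x, of \<tau>] pos by simp
  qed
  obtain F' where F: "\<And>t. (F has_real_derivative F' t) (at t)"
    and F': "\<And>t. (F' has_real_derivative F t - G t - 2 * \<epsilon>) (at t)"
    unfolding F_def G_def using bent_profile_derivatives by blast
  have Fadd: "((\<lambda>t. F (t + c)) has_real_derivative F' (t + c)) (at t)" for t c
    using F[of "t + c"] by (simp add: DERIV_shift)
  have Fadd': "((\<lambda>t. F (c + t)) has_real_derivative F' (c + t)) (at t)" for t c
    using Fadd[of c t] by (simp add: add.commute)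
  have F'add: "((\<lambda>t. F' (t + c)) has_real_derivative F (t + c) - G (t + c) - 2 * \<epsilon>) (at t)" for t c
    using F'[of "t + c"] by (simp add: DERIV_shift)
  have F'add': "((\<lambda>t. F' (c + t)) has_real_derivative F (c + t) - G (c + t) - 2 * \<epsilon>) (at t)" for t c
    using F'add[of c t] by (simp add: add.commute)
  define h where "h = (\<lambda>\<sigma>. F (t + \<sigma>) + L * \<sigma>^4)"
  have h_min: "h \<tau> \<le> h \<sigma>" if "\<bar>\<sigma>\<bar> \<le> \<eta>" for \<sigma>
    using mx[OF x that] by (simp add: h_def t_def)
  have dh: "(h has_real_derivative F' (t + \<sigma>) + 4 * L * \<sigma>^3) (at \<sigma>)" for \<sigma>
    unfolding h_def by (auto intro!: derivative_eq_intros Fadd')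
  have "\<bar>\<tau> - \<sigma>\<bar> < \<eta> - \<bar>\<tau>\<bar> \<Longrightarrow> h \<tau> \<le> h \<sigma>" for \<sigma>
    by (rule h_min) linarith
  \<comment> \<open>With \<open>x\<close> fixed, \<tau> is an interior minimum of \<open>h\<close>.
    The cubic term vanishes only at \<tau> = 0, so any other shift forces a nonzero slope of
    \<open>F\<close>.\<close>
  then have crit: "F' (t + \<tau>) + 4 * L * \<tau>^3 = 0"
    using DERIV_local_min[OF dh, of "\<eta> - \<bar>\<tau>\<bar>" \<tau>] \<tau>\<eta> by auto
  have nondeg: "F' (t + \<tau>) \<noteq> 0 \<or> 0 \<le> F (t + \<tau>) - G (t + \<tau>) - 2 * \<epsilon>"
  proof (rule ccontr)
    assume contra: "\<not> ?thesis"
    then have [simp]: "\<tau> = 0" using crit \<open>0 < L\<close> by simp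
    have d1: "((\<lambda>\<sigma>. - h \<sigma>) has_real_derivative - (F' (t + \<sigma>) + 4 * L * \<sigma>^3)) (at \<sigma>)" for \<sigma>
      by (intro DERIV_minus dh)
    \<comment> \<open>The quartic penalty contributes nothing to the second derivative at 0. A
      negative second derivative of \<open>F\<close> would thus make 0 a strict local maximum of
      \<open>h\<close>, against its minimality.\<close>
    have d2: "((\<lambda>\<sigma>. - (F' (t + \<sigma>) + 4 * L * \<sigma>^3)) has_real_derivative - (F t - G t - 2 * \<epsilon>)) (at 0)"
      by (auto intro!: derivative_eq_intros F'add')
    obtain e where e: "0 < e" "\<And>\<sigma>. \<sigma> \<noteq> 0 \<Longrightarrow> \<bar>\<sigma> - 0\<bar> < e \<Longrightarrow> - h 0 < - h \<sigma>"
      using strict_local_min_second_derivative[OF d1 d2] contra by auto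
    define \<sigma> where "\<sigma> = min (e / 2) \<eta>"
    have "0 < \<sigma>" "\<sigma> < e" "\<sigma> \<le> \<eta>" using e \<tau>\<eta> by (auto simp: \<sigma>_def)
    then show False using e(2)[of \<sigma>] h_min[of \<sigma>] by simp
  qed
  have lm: "local_max_on U (\<lambda>x. u1 x - F (norm (x - x0) + \<tau>)) x"
    unfolding local_max_on_def
  proof (intro conjI exI[of _ "r - dist x x0"] ballI impI)
    fix y assume "dist y x < r - dist x x0"
    then have "y \<in> cball x0 r"
      using dist_triangle[of y x0 x] by (simp add: dist_commute)
    then show "u1 y - F (norm (y - x0) + \<tau>) \<le> u1 x - F (norm (x - x0) + \<tau>)"
      using mx[of y \<tau>] \<tau> by simp
  qed (use x U xr in auto)
  have "u1 x - u2 x \<le> F (t + \<tau>) - G (t + \<tau>) - 2 * \<epsilon>"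
    by (rule visc_sub_radial_test[OF sub Fadd F'add _ \<open>0 < t\<close> lm nondeg]) (simp add: t_def)
  then show False using ge \<open>0 < \<epsilon>\<close> by (simp add: t_def)
qed

lemma visc_sub_swap: "visc_sub U u1 u2 \<Longrightarrow> visc_sub U u2 u1"
  by (simp add: visc_sub_def)

text \<open>A violated cone inequality survives a small bending of the cone and produces a positive
  maximum of one of the two penalised excesses. The component with the larger maximum is handed to
  \<open>no_interior_maximum\<close>.\<close>

lemma visc_sub_imp_cone_comp_above:
  assumes sub: "visc_sub U u1 u2" and "continuous_on U u1" "continuous_on U u2"
  shows "cone_comp_above U u1 u2"
  unfolding cone_comp_above_def
proof (intro ballI allI impI)
  fix x0 r C1 C2 a b z
  assume "x0 \<in> U" "0 < r" and U: "cball x0 r \<subseteq> U"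
    and b1: "\<forall>x\<in>sphere x0 r \<union> {x0}. u1 x \<le> gcone1 x0 C1 C2 a b x \<and> u2 x \<le> gcone2 x0 C1 C2 a b x"
    and z: "z \<in> cball x0 r"
  have cont: "continuous_on (cball x0 r) u1" "continuous_on (cball x0 r) u2"
    using assms U continuous_on_subset by blast+
  show "u1 z \<le> gcone1 x0 C1 C2 a b z \<and> u2 z \<le> gcone2 x0 C1 C2 a b z"
  proof (rule ccontr)
    assume contra: "\<not> ?thesis"
    define m where "m = max (u1 z - gcone1 x0 C1 C2 a b z) (u2 z - gcone2 x0 C1 C2 a b z)"
    have "0 < m" using contra by (auto simp: m_def)
    \<comment> \<open>Since K > r^2, the bump is positive on the closed ball and makes the boundary
      inequalities strict; since \<epsilon> K = m / 2, it removes at most half of the violation at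
      \<open>z\<close>.\<close>
    define K where "K = r\<^sup>2 + 1"
    define \<epsilon> where "\<epsilon> = m / (2 * K)"
    have "0 < K" by (simp add: K_def add_nonneg_pos)
    then have "0 < \<epsilon>" using \<open>0 < m\<close> by (simp add: \<epsilon>_def)
    define F where "F = bent_profile \<epsilon> K C1 C2 a b"
    define G where "G = bent_profile \<epsilon> K (- C1) (- C2) a b"
    have FG: "F (norm (y - x0)) = gcone1 x0 C1 C2 a b y + \<epsilon> * (K - (norm (y - x0))\<^sup>2)"
      "G (norm (y - x0)) = gcone2 x0 C1 C2 a b y + \<epsilon> * (K - (norm (y - x0))\<^sup>2)" for y
      by (simp_all add: F_def G_def bent_profile_def gcone1_def gcone2_def)
    have str: "u1 y < F (norm (y - x0)) \<and> u2 y < G (norm (y - x0))" if "y \<in> sphere x0 r \<union> {x0}" for y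
    proof -
      have "0 < \<epsilon> * (K - (norm (y - x0))\<^sup>2)"
        using that \<open>0 < \<epsilon>\<close> \<open>0 < K\<close> by (auto simp: K_def dist_norm norm_minus_commute)
      then show ?thesis unfolding FG using b1 that by force
    qed
    define B where "B = sphere x0 r \<union> {x0}"
    have cFG: "continuous_on S (\<lambda>p. u1 (fst p) - F (norm (fst p - x0) + snd p))"
      "continuous_on S (\<lambda>p. u2 (fst p) - G (norm (fst p - x0) + snd p))"
      if "fst ` S \<subseteq> cball x0 r" for S :: "((real^'a) \<times> real) set"
      unfolding F_def G_def
      by (intro continuous_intros continuous_on_compose2[OF cont(1)]
          continuous_on_compose2[OF cont(2)] that; simp)+
    \<comment> \<open>Compactness of \<open>B\<close> gives a uniform gap \<open>q\<close>. On
      \<open>B\<close> the radius takes only the values 0 and \<open>r\<close>, so continuity of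
      \<open>H\<close> at these two points yields a shift range that works for all of
      \<open>B\<close>.\<close>
    have "\<exists>\<eta>>0. \<forall>y\<in>B. \<forall>\<tau>. \<bar>\<tau>\<bar> \<le> \<eta> \<longrightarrow> u y < H (norm (y - x0) + \<tau>)"
      if H: "\<And>y. y \<in> B \<Longrightarrow> u y < H (norm (y - x0))" and c: "continuous_on UNIV H"
        and cu: "continuous_on (cball x0 r) u" for u and H :: "real \<Rightarrow> real"
    proof -
      have B: "compact B" "B \<noteq> {}" "B \<subseteq> cball x0 r" using \<open>0 < r\<close> by (auto simp: B_def)
      have "continuous_on B (\<lambda>y. H (norm (y - x0)) - u y)"
        by (intro continuous_intros continuous_on_compose2[OF c] continuous_on_subset[OF cu]) (use B in auto)
      from continuous_attains_inf[OF B(1,2) this]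
      obtain y0 where y0: "y0 \<in> B" "\<And>y. y \<in> B \<Longrightarrow> H (norm (y0 - x0)) - u y0 \<le> H (norm (y - x0)) - u y"
        by blast
      define q where "q = H (norm (y0 - x0)) - u y0"
      have "0 < q" using H[OF y0(1)] by (simp add: q_def)
      have near: "\<exists>e>0. \<forall>\<tau>. \<bar>\<tau>\<bar> < e \<longrightarrow> \<bar>H (t + \<tau>) - H t\<bar> < q" for t
      proof -
        obtain e where "e > 0" "\<And>s. dist s t < e \<Longrightarrow> dist (H s) (H t) < q"
          using c \<open>0 < q\<close> unfolding continuous_on_iff by blast
        then show ?thesis by (intro exI[of _ e]) (auto simp: dist_real_def)
      qed
      obtain e1 e2 where e: "e1 > 0" "e2 > 0" "\<And>\<tau>. \<bar>\<tau>\<bar> < e1 \<Longrightarrow> \<bar>H (r + \<tau>) - H r\<bar> < q"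
        "\<And>\<tau>. \<bar>\<tau>\<bar> < e2 \<Longrightarrow> \<bar>H (0 + \<tau>) - H 0\<bar> < q"
        using near[of r] near[of 0] by blast
      show ?thesis
      proof (intro exI[of _ "min e1 e2 / 2"] conjI ballI allI impI)
        fix y \<tau> assume y: "y \<in> B" and "\<bar>\<tau>\<bar> \<le> min e1 e2 / 2"
        then have t: "\<bar>\<tau>\<bar> < e1" "\<bar>\<tau>\<bar> < e2" using e by auto
        have "norm (y - x0) = r \<or> norm (y - x0) = 0"
          using y by (auto simp: B_def dist_norm norm_minus_commute)
        then have "\<bar>H (norm (y - x0) + \<tau>) - H (norm (y - x0))\<bar> < q"
          using e(3)[OF t(1)] e(4)[OF t(2)] by auto
        then show "u y < H (norm (y - x0) + \<tau>)" using y0(2)[OF y] by (simp add: q_def)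
      qed (use e in auto)
    qed
    note margin = this
    have cHG: "continuous_on UNIV F" "continuous_on UNIV G"
      unfolding F_def G_def by (rule continuous_on_bent_profile[OF continuous_on_id])+
    obtain \<eta>1 where \<eta>1: "\<eta>1 > 0" "\<And>y \<tau>. y \<in> B \<Longrightarrow> \<bar>\<tau>\<bar> \<le> \<eta>1 \<Longrightarrow> u1 y < F (norm (y - x0) + \<tau>)"
      using margin[of u1 F, OF _ cHG(1) cont(1)] str unfolding B_def by blast
    obtain \<eta>2 where \<eta>2: "\<eta>2 > 0" "\<And>y \<tau>. y \<in> B \<Longrightarrow> \<bar>\<tau>\<bar> \<le> \<eta>2 \<Longrightarrow> u2 y < G (norm (y - x0) + \<tau>)"
      using margin[of u2 G, OF _ cHG(2) cont(2)] str unfolding B_def by blast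
    define \<eta> where "\<eta> = min \<eta>1 \<eta>2"
    have "0 < \<eta>" using \<eta>1 \<eta>2 by (simp add: \<eta>_def)
    define S where "S = cball x0 r \<times> {-\<eta>..\<eta>}"
    have S: "compact S" "S \<noteq> {}" "fst ` S \<subseteq> cball x0 r"
      using \<open>0 < r\<close> \<open>0 < \<eta>\<close> by (auto simp: S_def compact_Times)
    have Sin: "(y, \<tau>) \<in> S \<longleftrightarrow> y \<in> cball x0 r \<and> \<bar>\<tau>\<bar> \<le> \<eta>" for y \<tau> by (auto simp: S_def)
    obtain M1 where M1: "\<And>p. p \<in> S \<Longrightarrow> u1 (fst p) - F (norm (fst p - x0) + snd p) \<le> M1"
      using continuous_attains_sup[OF S(1,2) cFG(1)[OF S(3)]] by blast
    obtain M2 where M2: "\<And>p. p \<in> S \<Longrightarrow> u2 (fst p) - G (norm (fst p - x0) + snd p) \<le> M2"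
      using continuous_attains_sup[OF S(1,2) cFG(2)[OF S(3)]] by blast
    \<comment> \<open>Chosen so that at shifts of modulus \<eta> the penalty is at least the maximal
      excess of either component.\<close>
    define L where "L = (\<bar>M1\<bar> + \<bar>M2\<bar> + 1) / \<eta>^4"
    have "0 < L" and L: "M1 \<le> L * \<eta>^4" "M2 \<le> L * \<eta>^4"
      using \<open>0 < \<eta>\<close> by (simp_all add: L_def)
    define \<Phi> where "\<Phi> = (\<lambda>p. u1 (fst p) - F (norm (fst p - x0) + snd p) - L * (snd p)^4)"
    define \<Psi> where "\<Psi> = (\<lambda>p. u2 (fst p) - G (norm (fst p - x0) + snd p) - L * (snd p)^4)"
    have "continuous_on S \<Phi>" "continuous_on S \<Psi>"
      unfolding \<Phi>_def \<Psi>_def by (intro continuous_intros cFG[OF S(3)])+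
    then obtain p q where p: "p \<in> S" "\<And>p'. p' \<in> S \<Longrightarrow> \<Phi> p' \<le> \<Phi> p"
      and q: "q \<in> S" "\<And>p'. p' \<in> S \<Longrightarrow> \<Psi> p' \<le> \<Psi> q"
      using continuous_attains_sup[OF S(1,2)] by metis
    have pos: "0 < max (\<Phi> p) (\<Psi> q)"
    proof -
      have zS: "(z, 0) \<in> S" using z \<open>0 < \<eta>\<close> by (simp add: S_def)
      have "\<epsilon> * (K - (norm (z - x0))\<^sup>2) \<le> \<epsilon> * K"
        using \<open>0 < \<epsilon>\<close> by simp
      also have "\<dots> < m" using \<open>0 < K\<close> \<open>0 < m\<close> by (simp add: \<epsilon>_def)
      finally have "0 < max (\<Phi> (z, 0)) (\<Psi> (z, 0))"
        by (auto simp: \<Phi>_def \<Psi>_def FG m_def)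
      then show ?thesis using p(2)[OF zS] q(2)[OF zS] by (auto simp: max_def split: if_splits)
    qed
    show False
    proof (cases "\<Psi> q \<le> \<Phi> p")
      case True
      obtain x \<tau> where xt: "p = (x, \<tau>)" by (cases p)
      show False
      proof (rule no_interior_maximum[OF sub U \<open>0 < \<epsilon>\<close> \<open>0 < L\<close>,
            of \<eta> K C1 C2 a b x \<tau>, folded F_def G_def])
        show "u1 y < F (norm (y - x0) + \<sigma>)" if "y \<in> sphere x0 r \<union> {x0}" "\<bar>\<sigma>\<bar> \<le> \<eta>" for y \<sigma>
          using \<eta>1 that by (auto simp: \<eta>_def B_def)
        show "u1 y - F (norm (y - x0) + \<sigma>) \<le> L * \<eta>^4" if "y \<in> cball x0 r" "\<bar>\<sigma>\<bar> = \<eta>" for y \<sigma>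
          using M1[of "(y, \<sigma>)"] L(1) that Sin[of y \<sigma>] by force
        show "x \<in> cball x0 r" "\<bar>\<tau>\<bar> \<le> \<eta>" using p(1) by (auto simp: xt Sin)
        show "u1 y - F (norm (y - x0) + \<sigma>) - L * \<sigma>^4 \<le> u1 x - F (norm (x - x0) + \<tau>) - L * \<tau>^4"
          if "y \<in> cball x0 r" "\<bar>\<sigma>\<bar> \<le> \<eta>" for y \<sigma>
          using p(2)[of "(y, \<sigma>)"] that Sin[of y \<sigma>] by (simp add: xt \<Phi>_def)
        show "0 < u1 x - F (norm (x - x0) + \<tau>) - L * \<tau>^4"
          using pos True by (simp add: xt \<Phi>_def)
        \<comment> \<open>From \<Psi> p \<le> \<Psi> q \<le> \<Phi> p, where the penalty at
          \<open>p\<close> is common to both sides and drops out.\<close>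
        show "u2 x - G (norm (x - x0) + \<tau>) \<le> u1 x - F (norm (x - x0) + \<tau>)"
          using q(2)[OF p(1)] True by (simp add: xt \<Phi>_def \<Psi>_def)
      qed
    next
      case False
      obtain x \<tau> where xt: "q = (x, \<tau>)" by (cases q)
      show False
      \<comment> \<open>The roles of the components are exchanged: negated constants turn
        \<open>F\<close> into \<open>G\<close> and conversely.\<close>
      proof (rule no_interior_maximum[OF visc_sub_swap[OF sub] U \<open>0 < \<epsilon>\<close> \<open>0 < L\<close>,
            of \<eta> K "- C1" "- C2" a b x \<tau>, unfolded minus_minus, folded F_def G_def])
        show "u2 y < G (norm (y - x0) + \<sigma>)" if "y \<in> sphere x0 r \<union> {x0}" "\<bar>\<sigma>\<bar> \<le> \<eta>" for y \<sigma>
          using \<eta>2 that by (auto simp: \<eta>_def B_def)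
        show "u2 y - G (norm (y - x0) + \<sigma>) \<le> L * \<eta>^4" if "y \<in> cball x0 r" "\<bar>\<sigma>\<bar> = \<eta>" for y \<sigma>
          using M2[of "(y, \<sigma>)"] L(2) that Sin[of y \<sigma>] by force
        show "x \<in> cball x0 r" "\<bar>\<tau>\<bar> \<le> \<eta>" using q(1) by (auto simp: xt Sin)
        show "u2 y - G (norm (y - x0) + \<sigma>) - L * \<sigma>^4 \<le> u2 x - G (norm (x - x0) + \<tau>) - L * \<tau>^4"
          if "y \<in> cball x0 r" "\<bar>\<sigma>\<bar> \<le> \<eta>" for y \<sigma>
          using q(2)[of "(y, \<sigma>)"] that Sin[of y \<sigma>] by (simp add: xt \<Psi>_def)
        show "0 < u2 x - G (norm (x - x0) + \<tau>) - L * \<tau>^4"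
          using pos False by (simp add: xt \<Psi>_def)
        show "u1 x - F (norm (x - x0) + \<tau>) \<le> u2 x - G (norm (x - x0) + \<tau>)"
          using p(2)[OF q(1)] False by (simp add: xt \<Phi>_def \<Psi>_def)
      qed
    qed
  qed
qed

section \<open>From comparison with cones to viscosity subsolutions\<close>

text \<open>The cone profile with C1 = c / 2 and C2 = 0 has second derivative close to
  \<open>c\<close> near 0, hence above \<kappa>. Fitting it to \<open>A\<close> at the vertex and to
  \<open>M\<close> on the sphere, comparison and uniform convexity improve the chord bound by the
  last term.\<close>

lemma cone_comp_above_imp_interpolation:
  assumes comp: "cone_comp_above U u1 u2" and "open U" "x \<in> U"
    and "continuous_on U u1" "continuous_on U u2" and \<kappa>: "\<kappa> < u1 x - u2 x"
  obtains \<rho> where "0 < \<rho>"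
    "\<And>r y A M. 0 < r \<Longrightarrow> r < \<rho> \<Longrightarrow> dist x y \<le> r \<Longrightarrow> u1 y \<le> A \<Longrightarrow> \<forall>w\<in>sphere y r. u1 w \<le> M \<Longrightarrow>
      u1 x \<le> (1 - dist x y / r) * A + dist x y / r * M - \<kappa> / 2 * dist x y * (r - dist x y)"
proof -
  \<comment> \<open>Three strict gaps: \<open>E\<close>, which is both the second derivative of the
    profile and the difference of the two cones, stays between \<kappa> and \<open>c1\<close> for
    small radii, while u1 - u2 stays above \<open>c1\<close> near \<open>x\<close>.\<close>
  define c where "c = (\<kappa> + (u1 x - u2 x)) / 2"
  define c1 where "c1 = (c + (u1 x - u2 x)) / 2"
  have c: "\<kappa> < c" "c < c1" "c1 < u1 x - u2 x" using \<kappa> by (auto simp: c_def c1_def field_simps)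
  define E where "E = (\<lambda>t::real. c * exp (sqrt 2 * t))"
  have "(E \<longlongrightarrow> c) (at 0)" unfolding E_def by (auto intro!: tendsto_eq_intros)
  then have "\<forall>\<^sub>F t in at 0. \<kappa> < E t \<and> E t < c1"
    using c by (intro eventually_conj order_tendstoD) auto
  then obtain \<rho>1 where "0 < \<rho>1" and \<rho>1: "\<And>t. t \<noteq> 0 \<Longrightarrow> \<bar>t\<bar> < \<rho>1 \<Longrightarrow> \<kappa> < E t \<and> E t < c1"
    unfolding eventually_at by (auto simp: dist_real_def)
  have E: "\<kappa> < E t \<and> E t < c1" if "\<bar>t\<bar> < \<rho>1" for t
    using \<rho>1[of t] that c by (cases "t = 0") (auto simp: E_def)
  have "isCont (\<lambda>y. u1 y - u2 y) x"
    using assms by (intro continuous_intros) (auto simp: continuous_on_eq_continuous_at)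
  then have "((\<lambda>y. u1 y - u2 y) \<longlongrightarrow> u1 x - u2 x) (at x)" by (simp add: isCont_def)
  then have "\<forall>\<^sub>F y in at x. c1 < u1 y - u2 y" using c(3) by (rule order_tendstoD)
  then obtain \<rho>2 where "0 < \<rho>2" and "\<And>y. y \<noteq> x \<Longrightarrow> dist y x < \<rho>2 \<Longrightarrow> c1 < u1 y - u2 y"
    unfolding eventually_at by auto
  then have \<rho>2: "c1 < u1 y - u2 y" if "dist y x < \<rho>2" for y
    using that c by (cases "y = x") auto
  obtain \<rho>3 where "0 < \<rho>3" and \<rho>3: "ball x \<rho>3 \<subseteq> U" using \<open>open U\<close> \<open>x \<in> U\<close> openE by blast
  \<comment> \<open>The halves account for points of the ball about \<open>y\<close> lying up to 2 r
    away from \<open>x\<close>.\<close>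
  define \<rho> where "\<rho> = Min {\<rho>1, \<rho>2 / 2, \<rho>3 / 2}"
  show thesis
  proof
    show "0 < \<rho>" using \<open>0 < \<rho>1\<close> \<open>0 < \<rho>2\<close> \<open>0 < \<rho>3\<close> by (simp add: \<rho>_def)
    fix r y A M
    assume r: "0 < r" "r < \<rho>" and d: "dist x y \<le> r" and A: "u1 y \<le> A" and M: "\<forall>w\<in>sphere y r. u1 w \<le> M"
    have r': "r < \<rho>1" "2 * r < \<rho>2" "2 * r < \<rho>3" using r by (auto simp: \<rho>_def)
    have near: "dist w x \<le> 2 * r" if "w \<in> cball y r" for w
      using that d dist_triangle[of w x y] by (simp add: dist_commute)
    then have cb: "cball y r \<subseteq> U" using \<rho>3 r' by (force simp: dist_commute)
    define b where "b = A - c / 2"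
    define a where "a = (M - c / 2 * exp (sqrt 2 * r) - b) / r"
    define f where "f = (\<lambda>t. c / 2 * exp (sqrt 2 * t) + a * t + b)"
    have f0: "f 0 = A" by (simp add: f_def b_def)
    have fr: "f r = M" using r by (simp add: f_def a_def)
    have g1: "gcone1 y (c / 2) 0 a b w = f (dist w y)" for w
      by (simp add: gcone1_def f_def dist_norm)
    have g2: "gcone2 y (c / 2) 0 a b w = f (dist w y) - E (dist w y)" for w
      by (simp add: gcone2_def f_def dist_norm E_def)
    \<comment> \<open>The bound for the second component is automatic: u2 < u1 - c1 \<le> f - c1 < f
      - E.\<close>
    have "\<forall>w\<in>sphere y r \<union> {y}. u1 w \<le> gcone1 y (c / 2) 0 a b w \<and> u2 w \<le> gcone2 y (c / 2) 0 a b w"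
    proof
      fix w assume w: "w \<in> sphere y r \<union> {y}"
      then have "w \<in> cball y r" using r by auto
      then have "dist w x < \<rho>2" using near r' by fastforce
      note u = \<rho>2[OF this]
      have "u1 w \<le> f (dist w y)" using w A M f0 fr by (auto simp: dist_commute)
      moreover have "E (dist w y) < c1" using E[of "dist w y"] w r r' by (auto simp: dist_commute)
      ultimately show "u1 w \<le> gcone1 y (c / 2) 0 a b w \<and> u2 w \<le> gcone2 y (c / 2) 0 a b w"
        unfolding g1 g2 using u by linarith
    qed
    moreover have "x \<in> cball y r" "y \<in> U" using d cb r by (auto simp: dist_commute)
    ultimately have "u1 x \<le> gcone1 y (c / 2) 0 a b x"
      using comp r cb unfolding cone_comp_above_def by blast
    then have ux: "u1 x \<le> f (dist x y)" by (simp add: g1)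
    \<comment> \<open>Subtracting the parabola leaves a convex function; its chord inequality on
      [0, r], with the parabola restored, is the claim.\<close>
    define h where "h = (\<lambda>t. f t - \<kappa> / 2 * t\<^sup>2)"
    have "convex_on {0..r} h"
    proof (rule f''_ge0_imp_convex)
      show "(h has_real_derivative (sqrt 2 * c / 2 * exp (sqrt 2 * t) + a - \<kappa> * t)) (at t)" for t
        unfolding h_def f_def by (auto intro!: derivative_eq_intros)
      show "((\<lambda>t. sqrt 2 * c / 2 * exp (sqrt 2 * t) + a - \<kappa> * t) has_real_derivative (E t - \<kappa>)) (at t)" for t
        unfolding E_def by (auto intro!: derivative_eq_intros)
      show "0 \<le> E t - \<kappa>" if "t \<in> {0..r}" for t using E[of t] that r' by auto
    qed auto
    from convex_onD[OF this, of "dist x y / r" 0 r]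
    have "h (dist x y) \<le> (1 - dist x y / r) * h 0 + dist x y / r * h r"
      using d r by simp
    then have "f (dist x y) \<le> (1 - dist x y / r) * A + dist x y / r * (M - \<kappa> / 2 * r\<^sup>2)
        + \<kappa> / 2 * (dist x y)\<^sup>2"
      by (simp add: h_def f0 fr)
    also have "\<dots> = (1 - dist x y / r) * A + dist x y / r * M - \<kappa> / 2 * dist x y * (r - dist x y)"
      using r by (simp add: field_simps power2_eq_square)
    finally show "u1 x \<le> (1 - dist x y / r) * A + dist x y / r * M - \<kappa> / 2 * dist x y * (r - dist x y)"
      using ux by simp
  qed
qed

lemma hessq_scaleR: "hessq f x (c *\<^sub>R v) = c\<^sup>2 * hessq f x v"
  by (simp add: hessq_def sum_distrib_left power2_eq_square mult_ac)

text \<open>The two mixed terms and the square term are bounded entry by entry, with the sum of the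
  absolute second partials as constant.\<close>

lemma hessq_add_le:
  obtains C where "0 \<le> C"
    "\<And>v w. hessq f x (v + w) \<le> hessq f x v + C * (2 * norm v * norm w + (norm w)\<^sup>2)"
proof
  let ?X = "\<lambda>k l. partial l (partial k f) x"
  let ?C = "\<Sum>k\<in>UNIV. \<Sum>l\<in>UNIV. \<bar>?X k l\<bar>"
  show "0 \<le> ?C" by (intro sum_nonneg) auto
  fix v w
  have comp: "\<bar>p$k\<bar> * \<bar>q$l\<bar> \<le> norm p * norm q" for p q :: "real^'a" and k l
    by (intro mult_mono component_le_norm_cart) auto
  have "?X k l * (v + w)$k * (v + w)$l \<le>
      ?X k l * v$k * v$l + \<bar>?X k l\<bar> * (2 * norm v * norm w + (norm w)\<^sup>2)" for k l
  proof -
    have "\<bar>v$k * w$l + w$k * v$l + w$k * w$l\<bar> \<le> \<bar>v$k\<bar> * \<bar>w$l\<bar> + \<bar>w$k\<bar> * \<bar>v$l\<bar> + \<bar>w$k\<bar> * \<bar>w$l\<bar>"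
      unfolding abs_mult[symmetric] by linarith
    also have "\<dots> \<le> norm v * norm w + norm w * norm v + norm w * norm w"
      by (intro add_mono comp)
    also have "\<dots> = 2 * norm v * norm w + (norm w)\<^sup>2"
      by (simp add: power2_eq_square)
    finally have "\<bar>?X k l\<bar> * \<bar>v$k * w$l + w$k * v$l + w$k * w$l\<bar>
        \<le> \<bar>?X k l\<bar> * (2 * norm v * norm w + (norm w)\<^sup>2)"
      by (intro mult_left_mono) auto
    moreover have "?X k l * (v$k * w$l + w$k * v$l + w$k * w$l)
        \<le> \<bar>?X k l\<bar> * \<bar>v$k * w$l + w$k * v$l + w$k * w$l\<bar>"
      by (metis abs_ge_self abs_mult)
    moreover have "?X k l * (v + w)$k * (v + w)$l =
        ?X k l * v$k * v$l + ?X k l * (v$k * w$l + w$k * v$l + w$k * w$l)"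
      by (simp add: algebra_simps)
    ultimately show ?thesis by linarith
  qed
  then have "hessq f x (v + w) \<le>
      (\<Sum>k\<in>UNIV. \<Sum>l\<in>UNIV. ?X k l * v$k * v$l + \<bar>?X k l\<bar> * (2 * norm v * norm w + (norm w)\<^sup>2))"
    unfolding hessq_def by (intro sum_mono)
  then show "hessq f x (v + w) \<le> hessq f x v + ?C * (2 * norm v * norm w + (norm w)\<^sup>2)"
    by (simp add: hessq_def sum.distrib sum_distrib_right)
qed

text \<open>Homogeneity of degree two reduces to unit vectors; \<open>hessq_add_le\<close> at v = 0
  bounds the set above, so that its \<open>Sup\<close> is an upper bound.\<close>

lemma hessq_le_Sup: "hessq f x h \<le> Sup (hessq f x ` sphere 0 1) * (norm h)\<^sup>2"
proof (cases "h = 0")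
  case True
  then show ?thesis by (simp add: hessq_def)
next
  case False
  obtain C where "0 \<le> C"
    and C: "\<And>v w. hessq f x (v + w) \<le> hessq f x v + C * (2 * norm v * norm w + (norm w)\<^sup>2)"
    using hessq_add_le[of f x] by blast
  have "bdd_above (hessq f x ` sphere 0 1)"
  proof (rule bdd_aboveI)
    fix q assume "q \<in> hessq f x ` sphere 0 1"
    then obtain v where "q = hessq f x v" "norm v = 1" by auto
    then show "q \<le> C" using C[of 0 v] by (simp add: hessq_def)
  qed
  moreover have "h /\<^sub>R norm h \<in> sphere 0 1" using False by simp
  ultimately have "hessq f x (h /\<^sub>R norm h) \<le> Sup (hessq f x ` sphere 0 1)"
    by (intro cSup_upper) auto
  then show ?thesis
    using False by (simp add: hessq_scaleR field_simps)
qed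

text \<open>With \<kappa> strictly between the upper infinity Laplacian \<Lambda> and u1 - u2, the
  interpolation gain at \<open>x\<close> is governed by \<kappa>, while the Taylor bound at the
  vertex and on the sphere permits only \<Lambda> plus small errors.\<close>

lemma cone_comp_above_test:
  assumes comp: "cone_comp_above U u1 u2" and "open U"
    and cont: "continuous_on U u1" "continuous_on U u2"
    and \<phi>: "C2_on U \<phi>" and mx: "local_max_on U (\<lambda>x. u1 x - \<phi> x) x"
  shows "u1 x - u2 x \<le> inf_lap_plus \<phi> x"
proof (rule ccontr)
  define \<Lambda> where "\<Lambda> = inf_lap_plus \<phi> x"
  assume "\<not> u1 x - u2 x \<le> inf_lap_plus \<phi> x"
  then have "\<Lambda> < u1 x - u2 x" by (simp add: \<Lambda>_def)
  then obtain \<kappa> where \<kappa>: "\<Lambda> < \<kappa>" "\<kappa> < u1 x - u2 x" using dense by blast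
  have "x \<in> U" using mx by (simp add: local_max_on_def)
  obtain \<rho> where "0 < \<rho>" and \<rho>: "\<And>r y A M. 0 < r \<Longrightarrow> r < \<rho> \<Longrightarrow> dist x y \<le> r \<Longrightarrow> u1 y \<le> A \<Longrightarrow>
      \<forall>w\<in>sphere y r. u1 w \<le> M \<Longrightarrow>
      u1 x \<le> (1 - dist x y / r) * A + dist x y / r * M - \<kappa> / 2 * dist x y * (r - dist x y)"
    using cone_comp_above_imp_interpolation[OF comp \<open>open U\<close> \<open>x \<in> U\<close> cont \<kappa>(2)] by blast
  obtain e1 where "0 < e1" and e1: "\<And>y. y \<in> U \<Longrightarrow> dist y x < e1 \<Longrightarrow> u1 y - \<phi> y \<le> u1 x - \<phi> x"
    using mx unfolding local_max_on_def by blast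
  obtain e2 where "0 < e2" and e2: "ball x e2 \<subseteq> U" using \<open>open U\<close> \<open>x \<in> U\<close> openE by blast
  define P where "P = norm (grad \<phi> x)"
  \<comment> \<open>For nonzero gradient the Taylor errors add up to 10 \<delta>, a quarter of
    \<kappa> - \<Lambda>, and the mixed Hessian terms will cost at most a half, so a quarter
    remains.\<close>
  define \<delta> where "\<delta> = (\<kappa> - \<Lambda>) / 40"
  have "0 < \<delta>" using \<kappa> by (simp add: \<delta>_def)
  obtain \<eta> where "0 < \<eta>" and \<eta>: "\<And>h. norm h < \<eta> \<Longrightarrow>
      \<phi> (x + h) \<le> \<phi> x + grad \<phi> x \<bullet> h + hessq \<phi> x h / 2 + \<delta> * (norm h)\<^sup>2"
    using C2_on_Taylor[OF \<phi> \<open>open U\<close> \<open>x \<in> U\<close> \<open>0 < \<delta>\<close>] by blast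
  define R where "R = Min {\<rho>, e1 / 2, e2 / 2, \<eta> / 2}"
  have "0 < R" using \<open>0 < \<rho>\<close> \<open>0 < e1\<close> \<open>0 < e2\<close> \<open>0 < \<eta>\<close> by (simp add: R_def)
  have R: "R \<le> \<rho>" "2 * R \<le> e1" "2 * R \<le> e2" "2 * R \<le> \<eta>"
    unfolding R_def by (auto simp: min_def)
  have u1_le: "u1 (x + h) \<le> u1 x + grad \<phi> x \<bullet> h + hessq \<phi> x h / 2 + \<delta> * (norm h)\<^sup>2"
    if "norm h < 2 * R" for h
  proof -
    have "x + h \<in> U" using e2 R that by (auto simp: dist_norm subset_iff)
    then show ?thesis using e1[of "x + h"] \<eta>[of h] R that by (simp add: dist_norm)
  qed
  show False
  proof (cases "grad \<phi> x = 0")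
    case True
    then have lam: "\<Lambda> = Sup (hessq \<phi> x ` sphere 0 1)" by (simp add: \<Lambda>_def inf_lap_plus_def)
    define \<mu> where "\<mu> = \<Lambda> / 2 + \<delta>"
    have "\<mu> < \<kappa> / 2" using \<kappa> by (simp add: \<mu>_def \<delta>_def field_simps)
    have u1_mu: "u1 (x + h) \<le> u1 x + \<mu> * (norm h)\<^sup>2" if "norm h < 2 * R" for h
      using u1_le[OF that] hessq_le_Sup[of \<phi> x h] True
      by (simp add: lam[symmetric] \<mu>_def algebra_simps)
    \<comment> \<open>This is the interpolation inequality at s = \<theta> r after subtracting
      \<open>u1 x\<close> and dividing by \<theta> r^2.\<close>
    have "((\<lambda>\<theta>. (1 - \<theta>) * \<theta> * \<mu> + (\<mu> + \<bar>\<mu>\<bar> * (2 * \<theta> + \<theta>\<^sup>2)) - \<kappa> / 2 * (1 - \<theta>)) \<longlongrightarrow> \<mu> - \<kappa> / 2) (at_right 0)"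
      by (auto intro!: tendsto_eq_intros)
    then have "\<forall>\<^sub>F \<theta> in at_right 0.
        (1 - \<theta>) * \<theta> * \<mu> + (\<mu> + \<bar>\<mu>\<bar> * (2 * \<theta> + \<theta>\<^sup>2)) - \<kappa> / 2 * (1 - \<theta>) < 0"
      using \<open>\<mu> < \<kappa> / 2\<close> by (intro order_tendstoD(2)) auto
    moreover have "\<forall>\<^sub>F \<theta>::real in at_right 0. \<theta> \<in> {0<..<1}"
      by (rule eventually_at_right_real) simp
    ultimately have "\<forall>\<^sub>F \<theta> in at_right 0.
        (1 - \<theta>) * \<theta> * \<mu> + (\<mu> + \<bar>\<mu>\<bar> * (2 * \<theta> + \<theta>\<^sup>2)) - \<kappa> / 2 * (1 - \<theta>) < 0 \<and> \<theta> \<in> {0<..<1}"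
      by (rule eventually_conj)
    then obtain \<theta> where \<theta>: "0 < \<theta>" "\<theta> < 1"
      and neg: "(1 - \<theta>) * \<theta> * \<mu> + (\<mu> + \<bar>\<mu>\<bar> * (2 * \<theta> + \<theta>\<^sup>2)) - \<kappa> / 2 * (1 - \<theta>) < 0"
      using eventually_happens'[OF trivial_limit_at_right_real]
      unfolding greaterThanLessThan_iff by blast
    define r where "r = R / 2"
    have r: "0 < r" "r < \<rho>" "2 * r < 2 * R" using \<open>0 < R\<close> R by (auto simp: r_def)
    obtain v :: "real^'a" where v: "norm v = 1" using norm_axis_1 by blast
    define y where "y = x + (\<theta> * r) *\<^sub>R v"
    have dy: "dist x y = \<theta> * r" using r \<theta> v by (simp add: y_def dist_norm)
    have "\<theta> * r \<le> r" using r \<theta> by simp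
    \<comment> \<open>On the sphere |h| lies between (1 - \<theta>) r and (1 + \<theta>) r, so |h|^2
      differs from r^2 by at most (2 \<theta> + \<theta>^2) r^2. The absolute value of \<mu> covers
      both signs.\<close>
    define M where "M = u1 x + (\<mu> + \<bar>\<mu>\<bar> * (2 * \<theta> + \<theta>\<^sup>2)) * r\<^sup>2"
    have "u1 y \<le> u1 x + \<mu> * (\<theta> * r)\<^sup>2"
      using u1_mu[of "(\<theta> * r) *\<^sub>R v"] r \<theta> v \<open>\<theta> * r \<le> r\<close> by (simp add: y_def)
    moreover have "\<forall>w\<in>sphere y r. u1 w \<le> M"
    proof
      fix w assume "w \<in> sphere y r"
      then have wy: "dist w y = r" by (simp add: dist_commute)
      define h where "h = w - x"
      have up: "norm h \<le> r + \<theta> * r"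
        using dist_triangle[of w x y] wy dy by (simp add: h_def dist_norm norm_minus_commute)
      have lo: "r - \<theta> * r \<le> norm h"
        using dist_triangle[of w y x] wy dy by (simp add: h_def dist_norm norm_minus_commute)
      have "(norm h)\<^sup>2 \<le> (r + \<theta> * r)\<^sup>2" using up by (simp add: power_mono)
      moreover have "(r - \<theta> * r)\<^sup>2 \<le> (norm h)\<^sup>2" using lo \<open>\<theta> * r \<le> r\<close> by (simp add: power_mono)
      moreover have "0 \<le> (\<theta> * r)\<^sup>2" by simp
      ultimately have "\<bar>(norm h)\<^sup>2 - r\<^sup>2\<bar> \<le> (2 * \<theta> + \<theta>\<^sup>2) * r\<^sup>2"
        by (simp add: abs_le_iff power2_eq_square algebra_simps)
      then have "\<bar>\<mu>\<bar> * \<bar>(norm h)\<^sup>2 - r\<^sup>2\<bar> \<le> \<bar>\<mu>\<bar> * ((2 * \<theta> + \<theta>\<^sup>2) * r\<^sup>2)"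
        by (intro mult_left_mono) auto
      moreover have "\<mu> * ((norm h)\<^sup>2 - r\<^sup>2) \<le> \<bar>\<mu>\<bar> * \<bar>(norm h)\<^sup>2 - r\<^sup>2\<bar>"
        by (metis abs_ge_self abs_mult)
      ultimately have "\<mu> * (norm h)\<^sup>2 \<le> (\<mu> + \<bar>\<mu>\<bar> * (2 * \<theta> + \<theta>\<^sup>2)) * r\<^sup>2"
        by (simp add: algebra_simps)
      moreover have "norm h < 2 * R" using up \<open>\<theta> * r \<le> r\<close> r by linarith
      ultimately show "u1 w \<le> M" using u1_mu[of h] by (simp add: h_def M_def)
    qed
    ultimately have "u1 x \<le> (1 - \<theta> * r / r) * (u1 x + \<mu> * (\<theta> * r)\<^sup>2) + \<theta> * r / r * M
        - \<kappa> / 2 * (\<theta> * r) * (r - \<theta> * r)"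
      using \<rho>[of r y "u1 x + \<mu> * (\<theta> * r)\<^sup>2" M] r \<open>\<theta> * r \<le> r\<close> unfolding dy by blast
    then have "0 \<le> (\<theta> * r\<^sup>2) *
        ((1 - \<theta>) * \<theta> * \<mu> + (\<mu> + \<bar>\<mu>\<bar> * (2 * \<theta> + \<theta>\<^sup>2)) - \<kappa> / 2 * (1 - \<theta>))"
      using r by (simp add: M_def power2_eq_square algebra_simps)
    moreover have "0 < \<theta> * r\<^sup>2" using \<theta> r by simp
    ultimately show False using neg by (simp add: zero_le_mult_iff)
  next
    case False
    then have "0 < P" by (simp add: P_def)
    define e where "e = grad \<phi> x /\<^sub>R P"
    have e: "norm e = 1" and gr: "grad \<phi> x = P *\<^sub>R e" using \<open>0 < P\<close> by (auto simp: e_def P_def)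
    then have ee: "e \<bullet> e = 1" by (simp add: dot_square_norm)
    have lam: "hessq \<phi> x e = \<Lambda>"
      using False \<open>0 < P\<close> by (simp add: \<Lambda>_def inf_lap_plus_def inf_lap_def e_def hessq_scaleR P_def field_simps)
    obtain C where "0 \<le> C"
      and C: "\<And>v w. hessq \<phi> x (v + w) \<le> hessq \<phi> x v + C * (2 * norm v * norm w + (norm w)\<^sup>2)"
      using hessq_add_le[of \<phi> x] by blast
    \<comment> \<open>Makes 9 C^2 r at most (\<kappa> - \<Lambda>) P; the added 1 keeps the
      denominator positive when \<open>C\<close> is 0.\<close>
    define r where "r = min (R / 2) ((\<kappa> - \<Lambda>) * P / (9 * C\<^sup>2 + 1))"
    have C1: "0 < 9 * C\<^sup>2 + 1" by (simp add: add_nonneg_pos)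
    have r: "0 < r" "r < \<rho>" "r < R"
      using \<open>0 < R\<close> R \<kappa> \<open>0 < P\<close> C1 by (auto simp: r_def)
    have "r \<le> (\<kappa> - \<Lambda>) * P / (9 * C\<^sup>2 + 1)" by (simp add: r_def)
    then have rC: "9 * C\<^sup>2 * r + r \<le> (\<kappa> - \<Lambda>) * P" using C1 by (simp add: pos_le_divide_eq algebra_simps)
    \<comment> \<open>Half a radius against the gradient: \<open>x\<close> is the midpoint between
      \<open>y\<close> and y + r e, where the linear part is largest on the sphere.\<close>
    define y where "y = x - (r / 2) *\<^sub>R e"
    have dy: "dist x y = r / 2" using r e by (simp add: y_def dist_norm)
    \<comment> \<open>\<open>A\<close> is the Taylor bound at the vertex. In \<open>M\<close>, the
      factor 9/4 comes from |h| \<le> 3 r / 2, and the last term bounds what deviation from the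
      direction \<open>e\<close> can gain.\<close>
    define A where "A = u1 x - r / 2 * P + \<Lambda> * r\<^sup>2 / 8 + \<delta> * r\<^sup>2 / 4"
    define M where "M = u1 x + r / 2 * P + \<Lambda> * r\<^sup>2 / 8 + 9 / 4 * \<delta> * r\<^sup>2 + 9 / 8 * C\<^sup>2 * r^3 / P"
    have "u1 y \<le> A"
      using u1_le[of "- (r / 2) *\<^sub>R e"] r e ee hessq_scaleR[of \<phi> x "- (r / 2)" e]
      by (simp add: y_def A_def gr lam power2_eq_square algebra_simps)
    moreover have "\<forall>w\<in>sphere y r. u1 w \<le> M"
    proof
      fix w assume w: "w \<in> sphere y r"
      define \<omega> where "\<omega> = (w - y) /\<^sub>R r"
      define h where "h = w - x"
      define d where "d = norm (\<omega> - e)"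
      have \<omega>: "norm \<omega> = 1" using w r by (simp add: \<omega>_def dist_norm norm_minus_commute)
      have h: "h = (r / 2) *\<^sub>R e + r *\<^sub>R (\<omega> - e)"
        using r by (simp add: h_def \<omega>_def y_def algebra_simps flip: scaleR_add_left)
      have h2: "h = r *\<^sub>R \<omega> - (r / 2) *\<^sub>R e"
        using r by (simp add: h_def \<omega>_def y_def algebra_simps)
      have "d \<le> 2" using norm_triangle_ineq4[of \<omega> e] \<omega> e by (simp add: d_def)
      have "0 \<le> d" by (simp add: d_def)
      have \<omega>\<omega>: "\<omega> \<bullet> \<omega> = 1" using \<omega> by (simp add: dot_square_norm)
      have "d\<^sup>2 = 2 - 2 * (e \<bullet> \<omega>)"
        using \<omega>\<omega> ee by (simp add: d_def power2_norm_eq_inner inner_diff inner_commute)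
      then have ew: "e \<bullet> \<omega> = 1 - d\<^sup>2 / 2" by (simp add: field_simps)
      have nh: "norm h \<le> 3 / 2 * r"
        using norm_triangle_ineq4[of "r *\<^sub>R \<omega>" "(r / 2) *\<^sub>R e"] r \<omega> e by (simp add: h2)
      then have nh2: "(norm h)\<^sup>2 \<le> 9 / 4 * r\<^sup>2"
        using power_mono[OF nh, of 2] by (simp add: power_mult_distrib power_divide)
      have "grad \<phi> x \<bullet> h = r / 2 * P - r * P * d\<^sup>2 / 2"
        by (simp add: gr h2 ew ee algebra_simps)
      moreover have "hessq \<phi> x h \<le> \<Lambda> * r\<^sup>2 / 4 + 3 * C * r\<^sup>2 * d"
      proof -
        have nb: "norm (r *\<^sub>R (\<omega> - e)) = r * d" using r by (simp add: d_def)
        have na: "norm ((r / 2) *\<^sub>R e) = r / 2" using r e by simp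
        have "hessq \<phi> x h \<le> (r / 2)\<^sup>2 * \<Lambda> + C * (2 * (r / 2) * (r * d) + (r * d)\<^sup>2)"
          using C[of "(r / 2) *\<^sub>R e" "r *\<^sub>R (\<omega> - e)"] unfolding h[symmetric] nb na hessq_scaleR lam .
        also have "\<dots> = \<Lambda> * r\<^sup>2 / 4 + C * r\<^sup>2 * d + C * r\<^sup>2 * d\<^sup>2"
          by (simp add: power2_eq_square algebra_simps)
        also have "\<dots> \<le> \<Lambda> * r\<^sup>2 / 4 + C * r\<^sup>2 * d + C * r\<^sup>2 * (2 * d)"
          using \<open>d \<le> 2\<close> \<open>0 \<le> d\<close> \<open>0 \<le> C\<close>
          by (intro add_left_mono mult_left_mono) (simp_all add: power2_eq_square mult_right_mono)
        finally show ?thesis by (simp add: algebra_simps)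
      qed
      \<comment> \<open>Completing the square in \<open>d\<close>: deviation by \<open>d\<close>
        costs r P d^2 / 2 in the linear part and gains only linearly in \<open>d\<close> from the
        Hessian.\<close>
      moreover have "- (r * P * d\<^sup>2 / 2) + 3 / 2 * C * r\<^sup>2 * d \<le> 9 / 8 * C\<^sup>2 * r^3 / P"
      proof -
        have "0 \<le> r * P / 2 * (d - 3 / 2 * C * r / P)\<^sup>2" using r \<open>0 < P\<close> by simp
        also have "\<dots> = r * P * d\<^sup>2 / 2 - 3 / 2 * C * r\<^sup>2 * d + 9 / 8 * C\<^sup>2 * r^3 / P"
          using \<open>0 < P\<close> by (simp add: field_simps power2_eq_square power3_eq_cube)
        finally show ?thesis by simp
      qed
      moreover have "\<delta> * (norm h)\<^sup>2 \<le> \<delta> * (9 / 4 * r\<^sup>2)"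
        using nh2 \<open>0 < \<delta>\<close> by (intro mult_left_mono) auto
      moreover have "norm h < 2 * R" using nh r by linarith
      ultimately show "u1 w \<le> M" using u1_le[of h] by (simp add: M_def h_def)
    qed
    ultimately have "u1 x \<le> (1 - r / 2 / r) * A + r / 2 / r * M - \<kappa> / 2 * (r / 2) * (r - r / 2)"
      using \<rho>[of r y A M] r unfolding dy by simp
    then have "u1 x \<le> A / 2 + M / 2 - \<kappa> * r\<^sup>2 / 8"
      using r by (simp add: power2_eq_square)
    \<comment> \<open>The first-order terms cancel because \<open>x\<close> is halfway.\<close>
    moreover have "A / 2 + M / 2 - \<kappa> * r\<^sup>2 / 8 - u1 x =
        r\<^sup>2 / 8 * (\<Lambda> + 10 * \<delta> + 9 / 2 * C\<^sup>2 * r / P - \<kappa>)"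
      using \<open>0 < P\<close> by (simp add: A_def M_def field_simps power2_eq_square power3_eq_cube)
    ultimately have "0 \<le> r\<^sup>2 / 8 * (\<Lambda> + 10 * \<delta> + 9 / 2 * C\<^sup>2 * r / P - \<kappa>)"
      by linarith
    then have "0 \<le> \<Lambda> + 10 * \<delta> + 9 / 2 * C\<^sup>2 * r / P - \<kappa>"
      using r by (simp add: zero_le_mult_iff)
    moreover have "9 / 2 * C\<^sup>2 * r / P \<le> (\<kappa> - \<Lambda>) / 2"
      using rC r \<open>0 < P\<close> by (simp add: field_simps)
    ultimately show False using \<kappa> unfolding \<delta>_def by argo
  qed
qed

section \<open>The two equivalences\<close>

lemma continuous_on_imp_usc_on: "continuous_on S f \<Longrightarrow> usc_on S f"
  unfolding usc_on_def continuous_on by (blast intro: order_tendstoD)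

lemma cone_comp_above_imp_visc_sub:
  assumes comp: "cone_comp_above U u1 u2" and "open U"
    and cont: "continuous_on U u1" "continuous_on U u2"
  shows "visc_sub U u1 u2"
  unfolding visc_sub_def
  using continuous_on_imp_usc_on[OF cont(1)] continuous_on_imp_usc_on[OF cont(2)]
    cone_comp_above_test[OF comp \<open>open U\<close> cont]
    cone_comp_above_test[OF cone_comp_above_swap[OF comp] \<open>open U\<close> cont(2,1)]
  by (auto simp: algebra_simps)

lemma visc_sub_iff_cone_comp_above:
  assumes "open U" "continuous_on U u1" "continuous_on U u2"
  shows "visc_sub U u1 u2 \<longleftrightarrow> cone_comp_above U u1 u2"
  using assms visc_sub_imp_cone_comp_above cone_comp_above_imp_visc_sub by blast

theorem mainTheorem6:
  fixes U :: "(real^'n::finite) set" and u1 u2 :: "real^'n \<Rightarrow> real"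
  assumes "smooth_bounded_domain U"
    and "continuous_on (closure U) u1" and "continuous_on (closure U) u2"
  shows "(visc_sub U u1 u2 \<longleftrightarrow> cone_comp_above U u1 u2) \<and>
         (visc_super U u1 u2 \<longleftrightarrow> cone_comp_below U u1 u2)"
proof -
  have "open U" using assms(1) by (simp add: smooth_bounded_domain_def)
  moreover have "continuous_on U u1" "continuous_on U u2"
    using assms(2,3) closure_subset continuous_on_subset by blast+
  \<comment> \<open>The supersolution half is the subsolution half for the negated pair.\<close>
  ultimately show ?thesis
    by (simp add: visc_super_iff_visc_sub_uminus cone_comp_below_iff_above_uminus
        visc_sub_iff_cone_comp_above continuous_on_minus)
qed

end
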